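(* There is a positive absolute constant $\alpha$ such that the following holds. Let $k \geq 2$ and $\ell\ge 2$ be fixed integers. Then for every sufficiently large integer $n$, \[ \max\left\{\left(1 - \frac{1}{k} \right)\frac{(\ell-1)!}{2z_{\ell, \ell}}(1 - o(1)),\; 1- \frac{\ell}{k}\right\} \leq \mathbf{d}(Q_n, C_{2 \ell}, Q_k) \leq 1 - \alpha \frac{\log k}{k\,2^k}. \]
   Context: $Q_n$ denotes the $n$-dimensional hypercube: its vertices are the binary vectors of length $n$, two vectors being adjacent iff they differ in exactly one coordinate (the flip coordinate of the edge). $C_m$ is the cycle on $m$ vertices. For graphs $G$ and $T$, a copy of $T$ in $G$ is a subgraph of $G$ isomorphic to $T$, and $N(G,T)$ is the number of copies of $T$ in $G$. A graph is $H$-free if it has no subgraph isomorphic to $H$. For subgraphs $T,H$ of $G$, $\mathrm{ex}(G,T,H)=\max\{N(G',T): G'\subseteq G,\ G' \text{ is } H\text{-free}\}$ and $\mathbf{d}(G,T,H)=\mathrm{ex}(G,T,H)/N(G,T)$. For integers $k,\ell$, $z_{k,\ell}$ denotes the number of copies of $C_{2\ell}$ in $Q_k$ whose edges together use all $k$ coordinates as flip coordinates. The term $o(1)$ denotes a nonnegative quantity tending to $0$ as $n\to\infty$ with $k,\ell$ fixed.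
   Formalization: For k = ℓ = 2 the first term of the maximum is dropped from the lower bound, since Q_2 = C_4 makes the density 0 while that term tends to 1/4; the bounds 1 − ℓ/k and 1 − α log k/(k 2^k) are kept for all k, ℓ ≥ 2. *)

theory Defs
  imports Complex_Main
begin

datatype 'a graph = Graph (verts: "'a set") (edges: "'a set set")

definition simple_graph :: "'a graph \<Rightarrow> bool" where
  "simple_graph G \<longleftrightarrow> (\<forall>e\<in>edges G. e \<subseteq> verts G \<and> card e = 2)"

definition subgraph :: "'a graph \<Rightarrow> 'a graph \<Rightarrow> bool" where
  "subgraph H G \<longleftrightarrow> simple_graph H \<and> verts H \<subseteq> verts G \<and> edges H \<subseteq> edges G"

definition graph_iso :: "'a graph \<Rightarrow> 'b graph \<Rightarrow> bool" where
  "graph_iso G H \<longleftrightarrow> (\<exists>f. bij_betw f (verts G) (verts H) \<and> (\<lambda>e. f ` e) ` edges G = edges H)"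

definition copies :: "'a graph \<Rightarrow> 'b graph \<Rightarrow> 'a graph set" where
  "copies G T = {S. subgraph S G \<and> graph_iso T S}"

definition num_copies :: "'a graph \<Rightarrow> 'b graph \<Rightarrow> nat" where
  "num_copies G T = card (copies G T)"

definition graph_free :: "'a graph \<Rightarrow> 'b graph \<Rightarrow> bool" where
  "graph_free G H \<longleftrightarrow> (\<nexists>S. subgraph S G \<and> graph_iso H S)"

(* For finite G and nonempty H the set below is finite and contains the value
   at the empty subgraph, so Max is a genuine maximum. *)
definition ex_copies :: "'a graph \<Rightarrow> 'b graph \<Rightarrow> 'c graph \<Rightarrow> nat" where
  "ex_copies G T H = Max {num_copies G' T | G'. subgraph G' G \<and> graph_free G' H}"

definition copy_density :: "'a graph \<Rightarrow> 'b graph \<Rightarrow> 'c graph \<Rightarrow> real" where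
  "copy_density G T H = real (ex_copies G T H) / real (num_copies G T)"

definition diff_coords :: "bool list \<Rightarrow> bool list \<Rightarrow> nat set" where
  "diff_coords u v = {i. i < length u \<and> u ! i \<noteq> v ! i}"

definition hypercube :: "nat \<Rightarrow> bool list graph" where
  "hypercube n = Graph {v. length v = n}
     {{u, v} | u v. length u = n \<and> length v = n \<and> card (diff_coords u v) = 1}"

(* On an edge of a hypercube this is the singleton consisting of its flip coordinate. *)
definition flip_coords :: "bool list set \<Rightarrow> nat set" where
  "flip_coords e = (\<Union>u\<in>e. \<Union>v\<in>e. diff_coords u v)"

(* The cycle on m vertices for m \<ge> 3. *)
definition cycle_graph :: "nat \<Rightarrow> nat graph" where
  "cycle_graph m = Graph {..<m} {{i, Suc i mod m} | i. i < m}"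

(* z_{k,l}: the copies of C_{2l} in Q_k that use all k flip coordinates.

   Pitfall: the lower bound (1 - 1/k) (l - 1)! / (2 z_{l,l}) (1 - o(1)) on the density of
   C_{2l} in Q_k-free subgraphs of Q_n fails for k = l = 2.  There z_{2,2} = 1, so the bound
   tends to 1/4, while Q_2 is the cycle C_4, so the density is 0. *)
definition full_cycles :: "nat \<Rightarrow> nat \<Rightarrow> nat" where
  "full_cycles k l = card {S \<in> copies (hypercube k) (cycle_graph (2 * l)).
     (\<Union>e\<in>edges S. flip_coords e) = {..<k}}"

end

theory Submission
  imports Defs "HOL-Library.FuncSet"
begin

text \<open>
  Up to the automorphisms of the cycle, the copies of \<open>C\<^sub>2\<^sub>l\<close> in \<open>Q\<^sub>n\<close> are closed walks: a start
  vertex, viewed as a subset of \<open>{..<n}\<close>, and a sequence of \<open>2l\<close> flip coordinates.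

  Lower bounds: deleting the edges of every \<open>k\<close>-th level destroys all copies of \<open>Q\<^sub>k\<close>. A closed walk
  uses every level an even number of times, so it meets at most \<open>l\<close> levels, and averaging over the
  \<open>k\<close> residues gives \<open>1 - l/k\<close>. A subcube of dimension \<open>l \<ge> 3\<close> contains at least \<open>(l - 1)!/2\<close> cycles
  inside a single level (averaged over its two extreme levels), and these survive with probability
  \<open>1 - 1/k\<close>; all but a fraction \<open>O(1/n)\<close> of the cycles use exactly \<open>l\<close> coordinates, which gives the
  other bound. For \<open>l = 2\<close> it is implied by the first one.

  Upper bound: by symmetry, the fraction of lost cycles is at least the fraction of missing
  edges. If a subcube of dimension \<open>k + 2\<close> has \<open>r\<close> missing edges that meet all its subcubes of
  dimension \<open>k\<close>, its coordinates are distinct functions from these edges to a set of size 3, whence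
  \<open>3 ^ r \<ge> k + 2\<close>.
\<close>

subsection \<open>Embeddings and copies\<close>

text \<open>Extensionality fixes the values off the vertex set, so that embeddings can be counted.
  The image graph may be any subgraph, not only an induced one.\<close>

definition embeddings :: "'a graph \<Rightarrow> 'b graph \<Rightarrow> ('a \<Rightarrow> 'b) set" where
  "embeddings T G = {f \<in> extensional (verts T). inj_on f (verts T) \<and> f ` verts T \<subseteq> verts G
     \<and> (\<lambda>e. f ` e) ` edges T \<subseteq> edges G}"

definition map_graph :: "('a \<Rightarrow> 'b) \<Rightarrow> 'a graph \<Rightarrow> 'b graph" where
  "map_graph f T = Graph (f ` verts T) ((\<lambda>e. f ` e) ` edges T)"

definition automorphisms :: "'a graph \<Rightarrow> ('a \<Rightarrow> 'a) set" where
  "automorphisms T = {g \<in> extensional (verts T). bij_betw g (verts T) (verts T)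
     \<and> (\<lambda>e. g ` e) ` edges T = edges T}"

lemma map_graph_sel [simp]:
  "verts (map_graph f T) = f ` verts T" "edges (map_graph f T) = (\<lambda>e. f ` e) ` edges T"
  by (auto simp: map_graph_def)

lemma graph_eqI: "verts G = verts H \<Longrightarrow> edges G = edges H \<Longrightarrow> G = H"
  by (cases G; cases H) auto

lemma finite_subgraphs:
  assumes "finite (verts G)"
  shows "finite {S. subgraph S G}"
proof (rule finite_subset)
  show "{S. subgraph S G} \<subseteq> (\<lambda>(V, E). Graph V E) ` (Pow (verts G) \<times> Pow (Pow (verts G)))"
  proof
    fix S assume "S \<in> {S. subgraph S G}"
    then have "verts S \<subseteq> verts G" "edges S \<subseteq> Pow (verts G)"
      by (auto simp: subgraph_def simple_graph_def)
    then show "S \<in> (\<lambda>(V, E). Graph V E) ` (Pow (verts G) \<times> Pow (Pow (verts G)))"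
      by (intro image_eqI[of _ _ "(verts S, edges S)"]) auto
  qed
qed (use assms in auto)

lemma finite_copies: "finite (verts G) \<Longrightarrow> finite (copies G T)"
  by (rule finite_subset[OF _ finite_subgraphs]) (auto simp: copies_def)

lemma finite_embeddings:
  assumes "finite (verts T)" "finite (verts G)"
  shows "finite (embeddings T G)"
  by (rule finite_subset[OF _ finite_PiE[OF assms(1), of "\<lambda>_. verts G"]])
     (use assms in \<open>auto simp: embeddings_def PiE_def\<close>)

lemma map_graph_in_copies:
  assumes "simple_graph T" "f \<in> embeddings T G"
  shows "map_graph f T \<in> copies G T"
proof -
  have inj: "inj_on f (verts T)" using assms(2) by (auto simp: embeddings_def)
  have "simple_graph (map_graph f T)"
    using assms(1) inj by (fastforce simp: simple_graph_def card_image inj_on_subset)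
  then show ?thesis using assms(2) inj
    by (auto simp: copies_def subgraph_def graph_iso_def embeddings_def bij_betw_def)
qed

text \<open>The embeddings with a given image form a torsor under the automorphism group.\<close>

lemma card_embeddings_onto:
  assumes T: "simple_graph T" and S: "S \<in> copies G T"
  shows "card {f \<in> embeddings T G. map_graph f T = S} = card (automorphisms T)"
proof -
  let ?V = "verts T"
  let ?F = "{f \<in> embeddings T G. map_graph f T = S}"
  from S obtain h0 where h0: "bij_betw h0 ?V (verts S)" "(\<lambda>e. h0 ` e) ` edges T = edges S"
    by (auto simp: copies_def graph_iso_def)
  have sub: "e \<subseteq> ?V" if "e \<in> edges T" for e
    using T that by (auto simp: simple_graph_def)
  have SG: "verts S \<subseteq> verts G" "edges S \<subseteq> edges G"
    using S by (auto simp: copies_def subgraph_def)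
  have F: "?F = {f \<in> extensional ?V. bij_betw f ?V (verts S) \<and> (\<lambda>e. f ` e) ` edges T = edges S}"
  proof -
    have "map_graph f T = S \<longleftrightarrow> f ` ?V = verts S \<and> (\<lambda>e. f ` e) ` edges T = edges S" for f
      using map_graph_sel by (metis graph_eqI)
    then show ?thesis using SG by (auto simp: embeddings_def bij_betw_def)
  qed
  \<comment> \<open>Composition with one fixed isomorphism \<open>h0\<close> onto \<open>S\<close>
    turns automorphisms into embeddings; composition with its inverse \<open>?k\<close> leads
    back.\<close>
  let ?\<phi> = "\<lambda>g. restrict (h0 \<circ> g) ?V"
  let ?k = "inv_into ?V h0"
  have k: "bij_betw ?k (verts S) ?V" using h0(1) by (rule bij_betw_inv_into)
  have kh: "?k (h0 x) = x" if "x \<in> ?V" for x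
    using h0(1) that by (auto simp: bij_betw_def)
  have hk: "h0 (?k y) = y" if "y \<in> verts S" for y
    using h0(1) that by (auto simp: bij_betw_def f_inv_into_f)
  have restr: "(\<lambda>e. restrict f ?V ` e) ` edges T = (\<lambda>e. f ` e) ` edges T" for f :: "'a \<Rightarrow> 'c"
  proof (rule image_cong)
    fix e assume "e \<in> edges T"
    then show "restrict f ?V ` e = f ` e" using sub[of e] by (intro image_cong) auto
  qed simp
  have "bij_betw ?\<phi> (automorphisms T) ?F"
  proof (rule bij_betwI[where g = "\<lambda>f. restrict (?k \<circ> f) ?V"])
    show "?\<phi> \<in> automorphisms T \<rightarrow> ?F"
    proof
      fix g assume g: "g \<in> automorphisms T"
      then have "bij_betw (h0 \<circ> g) ?V (verts S)"
        using h0(1) by (auto simp: automorphisms_def intro: bij_betw_trans)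
      then have b: "bij_betw (?\<phi> g) ?V (verts S)" by (subst bij_betw_restrict_eq)
      have "(\<lambda>e. (h0 \<circ> g) ` e) ` edges T = (\<lambda>e. h0 ` e) ` ((\<lambda>e. g ` e) ` edges T)"
        by (simp only: image_comp[symmetric] image_image)
      then have "(\<lambda>e. ?\<phi> g ` e) ` edges T = edges S"
        using g h0(2) unfolding restr by (simp add: automorphisms_def)
      then show "?\<phi> g \<in> ?F" unfolding F using b by auto
    qed
  next
    show "(\<lambda>f. restrict (?k \<circ> f) ?V) \<in> ?F \<rightarrow> automorphisms T"
    proof
      fix f assume "f \<in> ?F"
      then have f: "bij_betw f ?V (verts S)" "(\<lambda>e. f ` e) ` edges T = edges S" unfolding F by auto
      then have b: "bij_betw (restrict (?k \<circ> f) ?V) ?V ?V"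
        using k by (subst bij_betw_restrict_eq) (auto intro: bij_betw_trans)
      have "(\<lambda>e. (?k \<circ> f) ` e) ` edges T = (\<lambda>e. ?k ` e) ` ((\<lambda>e. f ` e) ` edges T)"
        by (simp only: image_comp[symmetric] image_image)
      also have "\<dots> = (\<lambda>e. ?k ` e) ` ((\<lambda>e. h0 ` e) ` edges T)" using f(2) h0(2) by simp
      also have "\<dots> = (\<lambda>e. e) ` edges T"
        unfolding image_image
      proof (rule image_cong)
        fix e assume "e \<in> edges T"
        then have "(\<lambda>x. ?k (h0 x)) ` e = (\<lambda>x. x) ` e" using sub kh by (intro image_cong) auto
        then show "(\<lambda>x. ?k (h0 x)) ` e = e" by simp
      qed simp
      finally have "(\<lambda>e. restrict (?k \<circ> f) ?V ` e) ` edges T = edges T" unfolding restr by simp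
      then show "restrict (?k \<circ> f) ?V \<in> automorphisms T"
        using b unfolding automorphisms_def by blast
    qed
  next
    fix g assume g: "g \<in> automorphisms T"
    show "restrict (?k \<circ> ?\<phi> g) ?V = g"
    proof (rule extensionalityI[of _ ?V])
      fix x assume "x \<in> ?V"
      moreover have "g x \<in> ?V" using g \<open>x \<in> ?V\<close> by (auto simp: automorphisms_def bij_betw_def)
      ultimately show "restrict (?k \<circ> ?\<phi> g) ?V x = g x" using kh by simp
    qed (use g in \<open>auto simp: automorphisms_def\<close>)
  next
    fix f assume "f \<in> ?F"
    then have f: "bij_betw f ?V (verts S)" "f \<in> extensional ?V" unfolding F by auto
    show "?\<phi> (restrict (?k \<circ> f) ?V) = f"
    proof (rule extensionalityI[of _ ?V])
      fix x assume "x \<in> ?V"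
      moreover have "f x \<in> verts S" using f(1) \<open>x \<in> ?V\<close> by (auto simp: bij_betw_def)
      ultimately show "?\<phi> (restrict (?k \<circ> f) ?V) x = f x" using hk by simp
    qed (use f in auto)
  qed
  then show ?thesis by (simp add: bij_betw_same_card)
qed

text \<open>The embeddings are fibred over their images, and all fibres have the size of the
  automorphism group. The predicate \<open>P\<close> allows the count to be restricted to cycles
  using prescribed coordinates.\<close>

lemma card_embeddings:
  assumes T: "simple_graph T" "finite (verts T)" and G: "finite (verts G)"
  shows "card {f \<in> embeddings T G. P (map_graph f T)}
    = card (automorphisms T) * card {S \<in> copies G T. P S}"
proof -
  let ?C = "{S \<in> copies G T. P S}"
  have "{f \<in> embeddings T G. P (map_graph f T)}
      = (\<Union>S\<in>?C. {f \<in> embeddings T G. map_graph f T = S})"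
    using map_graph_in_copies[OF T(1)] by auto
  also have "card \<dots> = (\<Sum>S\<in>?C. card {f \<in> embeddings T G. map_graph f T = S})"
    using finite_copies[OF G, of T] finite_embeddings[OF T(2) G]
    by (intro card_UN_disjoint) auto
  also have "\<dots> = (\<Sum>S\<in>?C. card (automorphisms T))"
    by (rule sum.cong) (auto intro: card_embeddings_onto[OF T(1)])
  finally show ?thesis by simp
qed

section \<open>The cycle graph and its automorphism group\<close>

lemma cycle_graph_sel [simp]:
  "verts (cycle_graph m) = {..<m}" "edges (cycle_graph m) = {{i, Suc i mod m} | i. i < m}"
  by (auto simp: cycle_graph_def)

lemma Suc_mod_neq: "2 \<le> m \<Longrightarrow> i < m \<Longrightarrow> Suc i mod m \<noteq> i"
  by (cases "Suc i = m") auto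

lemma simple_cycle_graph:
  assumes "m \<ge> 2" shows "simple_graph (cycle_graph m)"
proof -
  have "{i, Suc i mod m} \<subseteq> {..<m} \<and> card {i, Suc i mod m} = 2" if "i < m" for i
    using that assms Suc_mod_neq[OF assms that] by (auto simp: card_2_iff)
  then show ?thesis by (auto simp: simple_graph_def simp del: insert_subset)
qed

lemma Suc_mod_inj:
  assumes "i < m" "j < m" "Suc i mod m = Suc j mod m"
  shows "i = j"
  using assms by (cases "Suc i = m"; cases "Suc j = m") auto

lemma cycle_edge_cases:
  assumes "{x, y} \<in> edges (cycle_graph m)"
  shows "y = Suc x mod m \<and> x < m \<or> x = Suc y mod m \<and> y < m"
  using assms by (auto simp: doubleton_eq_iff)

lemma finite_automorphisms: "finite (verts T) \<Longrightarrow> finite (automorphisms T)"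
  by (rule finite_subset[OF _ finite_PiE[of "verts T" "\<lambda>_. verts T"]])
     (auto simp: automorphisms_def PiE_def bij_betw_def)

lemma card_automorphisms_pos:
  assumes "simple_graph T" "finite (verts T)"
  shows "card (automorphisms T) > 0"
proof -
  have "(\<lambda>e. restrict id (verts T) ` e) ` edges T = (\<lambda>e. e) ` edges T"
  proof (rule image_cong)
    fix e assume "e \<in> edges T"
    then have "e \<subseteq> verts T" using assms(1) by (auto simp: simple_graph_def)
    then have "restrict id (verts T) ` e = id ` e" by (intro image_cong) auto
    then show "restrict id (verts T) ` e = e" by simp
  qed simp
  then have "restrict id (verts T) \<in> automorphisms T"
    by (auto simp: automorphisms_def bij_betw_restrict_eq)
  then show ?thesis using finite_automorphisms[OF assms(2)] by (auto simp: card_gt_0_iff)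
qed

text \<open>An automorphism is determined by the image of 0 and by the direction of traversal, which
  is what \<open>?\<psi>\<close> records.\<close>

lemma card_automorphisms_cycle:
  assumes m: "m \<ge> 3"
  shows "card (automorphisms (cycle_graph m)) \<le> 2 * m"
proof -
  let ?A = "automorphisms (cycle_graph m)"
  let ?\<psi> = "\<lambda>g. (g 0, g 1 = Suc (g 0) mod m)"
  have edge: "{g i, g (Suc i mod m)} \<in> edges (cycle_graph m)" if "g \<in> ?A" "i < m" for g i
  proof -
    have "g ` {i, Suc i mod m} \<in> (\<lambda>e. g ` e) ` edges (cycle_graph m)"
      using that(2) by (intro imageI) auto
    then show ?thesis using that(1) by (simp add: automorphisms_def)
  qed
  have inj: "inj_on g {..<m}" "g ` {..<m} = {..<m}" if "g \<in> ?A" for g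
    using that by (auto simp: automorphisms_def bij_betw_def)
  have "inj_on ?\<psi> ?A"
  proof (rule inj_onI)
    fix g h assume gh: "g \<in> ?A" "h \<in> ?A" and eq: "?\<psi> g = ?\<psi> h"
    have g1: "{g 0, g 1} \<in> edges (cycle_graph m)" "{h 0, h 1} \<in> edges (cycle_graph m)"
      using edge[OF gh(1), of 0] edge[OF gh(2), of 0] m by auto
    have lt: "g i < m" "h i < m" if "i < m" for i
      using that inj(2)[OF gh(1)] inj(2)[OF gh(2)] by auto
    \<comment> \<open>Two consecutive values determine the next one: it is the neighbour of the
      second value other than the first.\<close>
    have *: "i < m - 1 \<longrightarrow> g i = h i \<and> g (Suc i) = h (Suc i)" for i
    proof (induction i)
      case 0
      have "g 1 = h 1"
        using cycle_edge_cases[OF g1(1)] cycle_edge_cases[OF g1(2)] eq by (metis prod.inject Suc_mod_inj)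
      then show ?case using eq by simp
    next
      case (Suc i)
      show ?case
      proof
        assume i: "Suc i < m - 1"
        then have IH: "g i = h i" "g (Suc i) = h (Suc i)" using Suc by auto
        have "{g (Suc i), g (Suc (Suc i))} \<in> edges (cycle_graph m)"
             "{h (Suc i), h (Suc (Suc i))} \<in> edges (cycle_graph m)"
             "{g i, g (Suc i)} \<in> edges (cycle_graph m)"
          using i edge[OF gh(1), of "Suc i"] edge[OF gh(2), of "Suc i"] edge[OF gh(1), of i]
          by auto
        note E = this[THEN cycle_edge_cases]
        have ne: "g (Suc (Suc i)) \<noteq> g i" "h (Suc (Suc i)) \<noteq> h i"
          using inj(1)[OF gh(1)] inj(1)[OF gh(2)] i by (auto dest!: inj_onD)
        show "g (Suc i) = h (Suc i) \<and> g (Suc (Suc i)) = h (Suc (Suc i))"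
          using E IH ne by (metis Suc_mod_inj)
      qed
    qed
    show "g = h"
    proof (rule extensionalityI[of _ "{..<m}"])
      fix x assume "x \<in> {..<m}"
      then show "g x = h x" using *[of "x - 1"] *[of 0] m by (cases x) auto
    qed (use gh in \<open>auto simp: automorphisms_def\<close>)
  qed
  moreover have "?\<psi> ` ?A \<subseteq> {..<m} \<times> UNIV" using inj(2) m by fastforce
  ultimately have "card ?A \<le> card ({..<m} \<times> (UNIV :: bool set))"
    by (rule card_inj_on_le) auto
  then show ?thesis by (simp add: card_cartesian_product)
qed

subsection \<open>Cycles in the hypercube as closed walks\<close>

definition sdiff :: "'a set \<Rightarrow> 'a set \<Rightarrow> 'a set" (infixl "\<triangle>" 65) where
  "A \<triangle> B = {x. (x \<in> A) \<noteq> (x \<in> B)}"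

lemma mem_sdiff [simp]: "x \<in> A \<triangle> B \<longleftrightarrow> (x \<in> A) \<noteq> (x \<in> B)"
  by (simp add: sdiff_def)

lemma sdiff_empty [simp]: "A \<triangle> {} = A" "{} \<triangle> A = A" and sdiff_self [simp]: "A \<triangle> A = {}"
  by auto

lemma sdiff_cancel [simp]: "A \<triangle> B = A \<triangle> C \<longleftrightarrow> B = C" "A \<triangle> (A \<triangle> B) = B" "A \<triangle> B \<triangle> B = A"
  by (auto simp: set_eq_iff)

lemma sdiff_assoc: "A \<triangle> B \<triangle> C = A \<triangle> (B \<triangle> C)"
  by auto

lemma sdiff_singleton: "x \<notin> A \<Longrightarrow> A \<triangle> {x} = insert x A"
  by auto

lemma sdiff_subset: "A \<subseteq> C \<Longrightarrow> B \<subseteq> C \<Longrightarrow> A \<triangle> B \<subseteq> C"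
  by auto

lemma finite_sdiff [simp]: "finite A \<Longrightarrow> finite B \<Longrightarrow> finite (A \<triangle> B)"
  by (rule finite_subset[of _ "A \<union> B"]) auto

section \<open>Vertices as sets of coordinates, edges as a vertex with a flip coordinate\<close>

definition enc :: "nat \<Rightarrow> nat set \<Rightarrow> bool list" where
  "enc n X = map (\<lambda>i. i \<in> X) [0..<n]"

definition dec :: "bool list \<Rightarrow> nat set" where
  "dec v = {i. i < length v \<and> v ! i}"

lemma length_enc [simp]: "length (enc n X) = n"
  by (simp add: enc_def)

lemma nth_enc [simp]: "i < n \<Longrightarrow> enc n X ! i \<longleftrightarrow> i \<in> X"
  by (simp add: enc_def)

lemma dec_enc [simp]: "X \<subseteq> {..<n} \<Longrightarrow> dec (enc n X) = X"
  by (auto simp: dec_def)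

lemma enc_dec [simp]: "length v = n \<Longrightarrow> enc n (dec v) = v"
  by (auto simp: dec_def intro: nth_equalityI)

lemma dec_subset: "length v = n \<Longrightarrow> dec v \<subseteq> {..<n}"
  by (auto simp: dec_def)

lemma enc_inject: "X \<subseteq> {..<n} \<Longrightarrow> Y \<subseteq> {..<n} \<Longrightarrow> enc n X = enc n Y \<longleftrightarrow> X = Y"
  by (metis dec_enc)

definition arc :: "nat \<Rightarrow> nat set \<Rightarrow> nat \<Rightarrow> bool list set" where
  "arc n X i = {enc n X, enc n (X \<triangle> {i})}"

lemma diff_coords_enc [simp]: "diff_coords (enc n X) (enc n Y) = (X \<triangle> Y) \<inter> {..<n}"
  by (auto simp: diff_coords_def)

lemma arc_sdiff: "arc n (X \<triangle> {i}) i = arc n X i"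
  by (auto simp: arc_def)

lemma flip_coords_arc: "i < n \<Longrightarrow> flip_coords (arc n X i) = {i}"
  by (auto simp: flip_coords_def arc_def)

lemma verts_hypercube [simp]: "verts (hypercube n) = {v. length v = n}"
  by (simp add: hypercube_def)

lemma edges_hypercube: "edges (hypercube n) = {arc n X i | X i. X \<subseteq> {..<n} \<and> i < n}"
proof (intro equalityI subsetI)
  fix e assume "e \<in> edges (hypercube n)"
  then obtain u v where uv: "e = {u, v}" "length u = n" "length v = n" "card (diff_coords u v) = 1"
    by (auto simp: hypercube_def)
  define X Y where "X = dec u" and "Y = dec v"
  have XY: "u = enc n X" "v = enc n Y" "X \<subseteq> {..<n}" "Y \<subseteq> {..<n}"
    using uv dec_subset[of u n] dec_subset[of v n] unfolding X_def Y_def by simp_all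
  then have "(X \<triangle> Y) \<inter> {..<n} = X \<triangle> Y" by auto
  then have "card (X \<triangle> Y) = 1" using uv(4) unfolding XY(1,2) diff_coords_enc by simp
  then obtain i where i: "X \<triangle> Y = {i}" by (auto simp: card_1_singleton_iff)
  then have "Y = X \<triangle> {i}" by (metis sdiff_cancel(2))
  moreover have "i \<in> X \<triangle> Y" using i by simp
  then have "i < n" using XY(3,4) by auto
  ultimately show "e \<in> {arc n X i | X i. X \<subseteq> {..<n} \<and> i < n}"
    using uv(1) XY by (auto simp: arc_def)
next
  fix e assume "e \<in> {arc n X i | X i. X \<subseteq> {..<n} \<and> i < n}"
  then obtain X i where *: "e = arc n X i" "X \<subseteq> {..<n}" "i < n" by auto
  then have "diff_coords (enc n X) (enc n (X \<triangle> {i})) = {i}" by auto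
  then have "card (diff_coords (enc n X) (enc n (X \<triangle> {i}))) = 1" by simp
  then show "e \<in> edges (hypercube n)"
    using * unfolding hypercube_def arc_def graph.sel
    by (intro CollectI exI[of _ "enc n X"] exI[of _ "enc n (X \<triangle> {i})"]) auto
qed

text \<open>The flip coordinate can be recovered from the edge, so the only freedom left is which
  endpoint is named.\<close>

lemma arc_eq_iff:
  assumes "X \<subseteq> {..<n}" "Y \<subseteq> {..<n}" "i < n" "j < n"
  shows "arc n X i = arc n Y j \<longleftrightarrow> i = j \<and> (X = Y \<or> X = Y \<triangle> {i})"
proof
  assume eq: "arc n X i = arc n Y j"
  have "{i} = {j}" using flip_coords_arc[OF assms(3)] flip_coords_arc[OF assms(4)] eq by metis
  moreover have "enc n X \<in> arc n Y j" using eq by (auto simp: arc_def)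
  then have "X = Y \<or> X = Y \<triangle> {j}"
    using assms by (auto simp: arc_def enc_inject sdiff_subset)
  ultimately show "i = j \<and> (X = Y \<or> X = Y \<triangle> {i})" by auto
qed (auto simp: arc_sdiff)

lemma finite_verts_hypercube: "finite (verts (hypercube n))"
  using finite_lists_length_eq[of "UNIV :: bool set" n] by simp

lemma enc_neq: "i < n \<Longrightarrow> enc n X \<noteq> enc n (X \<triangle> {i})"
  by (metis mem_sdiff nth_enc singletonI)

lemma simple_hypercube: "simple_graph (hypercube n)"
  unfolding simple_graph_def edges_hypercube
  by (auto simp: arc_def enc_neq)

section \<open>Parity sets and closed walks\<close>

text \<open>The coordinates flipped an odd number of times form the displacement of the walk: it
  ends at \<open>X \<triangle> par s\<close> when it starts at \<open>X\<close>.\<close>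

definition par :: "'a list \<Rightarrow> 'a set" where
  "par s = {x. odd (count_list s x)}"

lemma par_Nil [simp]: "par [] = {}"
  by (simp add: par_def)

lemma par_Cons: "par (x # s) = {x} \<triangle> par s"
  by (auto simp: par_def)

lemma par_append: "par (s @ t) = par s \<triangle> par t"
  by (auto simp: par_def)

lemma par_take_Suc: "j < length s \<Longrightarrow> par (take (Suc j) s) = par (take j s) \<triangle> {s ! j}"
  by (simp add: take_Suc_conv_app_nth par_append par_Cons)

lemma par_subset: "par s \<subseteq> set s"
  by (auto simp: par_def dest: count_notin intro: ccontr)

lemma par_take_subset: "par (take j s) \<subseteq> set s"
  using par_subset[of "take j s"] set_take_subset[of j s] by blast

text \<open>Flip sequences of closed walks that visit no vertex twice: after \<open>j\<close> steps the walk
  from \<open>X\<close> is at \<open>X \<triangle> par (take j s)\<close>.\<close>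

definition good :: "nat \<Rightarrow> nat \<Rightarrow> nat list set" where
  "good n m = {s. length s = m \<and> set s \<subseteq> {..<n} \<and> par s = {}
     \<and> inj_on (\<lambda>j. par (take j s)) {..<m}}"

definition walk_map :: "nat \<Rightarrow> nat set \<times> nat list \<Rightarrow> nat \<Rightarrow> bool list" where
  "walk_map n = (\<lambda>(X, s). restrict (\<lambda>j. enc n (X \<triangle> par (take j s))) {..<length s})"

definition walks :: "nat \<Rightarrow> nat \<Rightarrow> (nat set \<times> nat list) set" where
  "walks n m = Pow {..<n} \<times> good n m"

lemma goodD:
  assumes "s \<in> good n m"
  shows "length s = m" "set s \<subseteq> {..<n}" "par s = {}" "inj_on (\<lambda>j. par (take j s)) {..<m}"
    "j < m \<Longrightarrow> s ! j < n" "par (take j s) \<subseteq> {..<n}"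
  using assms nth_mem[of j s] par_take_subset[of j s] unfolding good_def by blast+

lemma finite_good: "finite (good n m)"
  by (rule finite_subset[OF _ finite_lists_length_eq[of "{..<n}" m]]) (auto simp: good_def)

lemma finite_walks: "finite (walks n m)"
  by (auto simp: walks_def finite_good)

lemma card_walks: "card (walks n m) = 2 ^ n * card (good n m)"
  by (simp add: walks_def card_cartesian_product card_Pow)

lemma walk_map_edge:
  assumes "s \<in> good n m" "j < m" "m \<ge> 2"
  shows "{walk_map n (X, s) j, walk_map n (X, s) (Suc j mod m)} = arc n (X \<triangle> par (take j s)) (s ! j)"
proof -
  note g = goodD[OF assms(1)]
  have "walk_map n (X, s) (Suc j mod m) = enc n (X \<triangle> par (take (Suc j) s))"
    using g assms by (cases "Suc j = m") (auto simp: walk_map_def)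
  then show ?thesis
    using g assms by (simp add: walk_map_def arc_def par_take_Suc sdiff_assoc)
qed

lemma edges_map_cycle_graph:
  "(\<lambda>e. f ` e) ` edges (cycle_graph m) = (\<lambda>j. {f j, f (Suc j mod m)}) ` {..<m}"
proof -
  have "edges (cycle_graph m) = (\<lambda>j. {j, Suc j mod m}) ` {..<m}" by auto
  then show ?thesis by (simp only: image_image) simp
qed

lemma map_graph_walk_map_edges:
  assumes "s \<in> good n m" "m \<ge> 2"
  shows "edges (map_graph (walk_map n (X, s)) (cycle_graph m))
    = {arc n (X \<triangle> par (take j s)) (s ! j) | j. j < m}"
proof -
  have "edges (map_graph (walk_map n (X, s)) (cycle_graph m))
      = (\<lambda>j. {walk_map n (X, s) j, walk_map n (X, s) (Suc j mod m)}) ` {..<m}"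
    by (simp only: map_graph_sel edges_map_cycle_graph)
  also have "\<dots> = (\<lambda>j. arc n (X \<triangle> par (take j s)) (s ! j)) ` {..<m}"
    using walk_map_edge[OF assms(1) _ assms(2)] by (intro image_cong) auto
  finally show ?thesis by blast
qed

lemma flip_coords_walk_map:
  assumes "s \<in> good n m" "m \<ge> 2"
  shows "(\<Union>e\<in>edges (map_graph (walk_map n (X, s)) (cycle_graph m)). flip_coords e) = set s"
  unfolding map_graph_walk_map_edges[OF assms]
  using goodD(1,5)[OF assms(1)] by (fastforce simp: flip_coords_arc in_set_conv_nth)

text \<open>An embedding of the cycle is traced by exactly one walk: the start is the image of 0,
  and the flip coordinates are the differences of consecutive images.\<close>

lemma bij_betw_walk_map:
  assumes G: "subgraph G (hypercube n)" and m: "m \<ge> 2"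
  shows "bij_betw (walk_map n)
    {(X, s) \<in> walks n m. \<forall>j<m. arc n (X \<triangle> par (take j s)) (s ! j) \<in> edges G}
    (embeddings (cycle_graph m) G)"
  (is "bij_betw _ ?W ?E")
  unfolding bij_betw_def
proof
  show "inj_on (walk_map n) ?W"
  proof (rule inj_onI, clarify)
    fix X s Y t
    assume X: "(X, s) \<in> walks n m" and Y: "(Y, t) \<in> walks n m"
      and eq: "walk_map n (X, s) = walk_map n (Y, t)"
    note s = goodD[of s n m] and t = goodD[of t n m]
    have st: "s \<in> good n m" "t \<in> good n m" "X \<subseteq> {..<n}" "Y \<subseteq> {..<n}"
      using X Y by (auto simp: walks_def)
    have *: "X \<triangle> par (take j s) = Y \<triangle> par (take j t)" if "j < m" for j
    proof -
      have "enc n (X \<triangle> par (take j s)) = enc n (Y \<triangle> par (take j t))"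
        using fun_cong[OF eq, of j] that s(1) t(1) st by (simp add: walk_map_def)
      then show ?thesis
        using st s(6) t(6) by (simp add: enc_inject sdiff_subset)
    qed
    have XY: "X = Y" using *[of 0] m by simp
    have **: "par (take j s) = par (take j t)" if "j \<le> m" for j
      using *[of j] XY that st s(1,3) t(1,3) by (cases "j = m") auto
    have "s ! j = t ! j" if "j < m" for j
    proof -
      have "par (take j s) \<triangle> {s ! j} = par (take j t) \<triangle> {t ! j}"
        using **[of "Suc j"] that s(1) t(1) st by (simp add: par_take_Suc)
      then show ?thesis using **[of j] that by simp
    qed
    then show "X = Y \<and> s = t" using XY st s(1) t(1) by (simp add: nth_equalityI)
  qed
next
  show "walk_map n ` ?W = ?E"
  proof (intro equalityI subsetI)
    fix f assume "f \<in> walk_map n ` ?W"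
    then obtain X s where f: "f = walk_map n (X, s)" and X: "X \<subseteq> {..<n}" and s: "s \<in> good n m"
      and e: "\<And>j. j < m \<Longrightarrow> arc n (X \<triangle> par (take j s)) (s ! j) \<in> edges G"
      by (auto simp: walks_def)
    note g = goodD[OF s]
    have edge: "{f j, f (Suc j mod m)} \<in> edges G" if "j < m" for j
      using walk_map_edge[OF s that m] e[OF that] f by simp
    have "inj_on f {..<m}"
    proof (rule inj_onI)
      fix i j assume "i \<in> {..<m}" "j \<in> {..<m}" "f i = f j"
      then have "par (take i s) = par (take j s)"
        using X g(1,6) by (simp add: f walk_map_def enc_inject sdiff_subset)
      then show "i = j" using g(4) \<open>i \<in> {..<m}\<close> \<open>j \<in> {..<m}\<close> by (auto dest: inj_onD)
    qed
    moreover have "f j \<in> verts G" if "j < m" for j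
      using edge[OF that] G by (auto simp: subgraph_def simple_graph_def)
    moreover have "f \<in> extensional {..<m}" using g(1) by (simp add: f walk_map_def)
    moreover have "(\<lambda>e. f ` e) ` edges (cycle_graph m) \<subseteq> edges G"
      using edge unfolding edges_map_cycle_graph by auto
    ultimately show "f \<in> ?E" unfolding embeddings_def by auto
  next
    fix f assume "f \<in> ?E"
    then have fe: "f \<in> extensional {..<m}" and finj: "inj_on f {..<m}"
      and fv: "\<And>j. j < m \<Longrightarrow> f j \<in> verts G"
      and fE: "\<And>j. j < m \<Longrightarrow> {f j, f (Suc j mod m)} \<in> edges G"
      unfolding embeddings_def edges_map_cycle_graph by auto
    \<comment> \<open>Indexing modulo \<open>m\<close> makes \<open>D m = D 0\<close>, so the
      closing edge of the cycle is treated like all the others.\<close>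
    define D where "D j = dec (f (j mod m))" for j
    have len: "length (f j) = n" if "j < m" for j
      using fv[OF that] G by (auto simp: subgraph_def)
    have D: "D j \<subseteq> {..<n}" for j
      using m len[of "j mod m"] by (auto simp: D_def intro!: dec_subset)
    have fD: "f j = enc n (D j)" if "j < m" for j
      using len[OF that] that by (simp add: D_def)
    have "\<exists>c<n. D (Suc j) = D j \<triangle> {c}" if j: "j < m" for j
    proof -
      have "{f j, f (Suc j mod m)} \<in> edges (hypercube n)"
        using fE[OF j] G by (auto simp: subgraph_def)
      then obtain X c where X: "X \<subseteq> {..<n}" "c < n" "{f j, f (Suc j mod m)} = arc n X c"
        unfolding edges_hypercube by auto
      have "f (Suc j mod m) = enc n (D (Suc j))"
        using fD[of "Suc j mod m"] m by (simp add: D_def)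
      then have "{enc n (D j), enc n (D (Suc j))} = {enc n X, enc n (X \<triangle> {c})}"
        using X(3) fD[OF j] by (simp add: arc_def)
      then have "D j = X \<and> D (Suc j) = X \<triangle> {c} \<or> D j = X \<triangle> {c} \<and> D (Suc j) = X"
        using X D by (auto simp: doubleton_eq_iff enc_inject sdiff_subset)
      then show ?thesis using X(2) by auto
    qed
    then obtain c where c: "\<And>j. j < m \<Longrightarrow> c j < n \<and> D (Suc j) = D j \<triangle> {c j}" by metis
    define s where "s = map c [0..<m]"
    have ls: "length s = m" by (simp add: s_def)
    have par: "par (take j s) = D 0 \<triangle> D j" if "j \<le> m" for j
      using that
    proof (induction j)
      case (Suc j)
      then show ?case using c[of j] ls by (simp add: par_take_Suc sdiff_assoc s_def)
    qed simp
    have fwalk: "f = walk_map n (D 0, s)"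
    proof (rule extensionalityI[OF fe])
      fix j assume "j \<in> {..<m}"
      then show "f j = walk_map n (D 0, s) j"
        using par[of j] fD ls by (simp add: walk_map_def)
    qed (simp add: walk_map_def ls)
    have s: "s \<in> good n m"
      unfolding good_def
    proof (intro CollectI conjI)
      show "par s = {}" using par[of m] ls by (simp add: D_def)
      show "inj_on (\<lambda>j. par (take j s)) {..<m}"
      proof (rule inj_onI)
        fix i j assume ij: "i \<in> {..<m}" "j \<in> {..<m}" "par (take i s) = par (take j s)"
        then have "D i = D j" using par by simp
        then have "f i = f j" using fD ij by simp
        then show "i = j" using finj ij by (auto dest: inj_onD)
      qed
      show "set s \<subseteq> {..<n}" using c by (auto simp: s_def)
    qed (rule ls)
    have "arc n (D 0 \<triangle> par (take j s)) (s ! j) \<in> edges G" if "j < m" for j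
      using walk_map_edge[OF s that m, of "D 0"] fE[OF that] fwalk by simp
    then show "f \<in> walk_map n ` ?W"
      using fwalk s D[of 0] by (auto simp: walks_def)
  qed
qed

lemma card_walks_in_subgraph:
  assumes G: "subgraph G (hypercube n)" and m: "m \<ge> 2"
  shows "card {(X, s) \<in> walks n m. \<forall>j<m. arc n (X \<triangle> par (take j s)) (s ! j) \<in> edges G}
    = card (automorphisms (cycle_graph m)) * num_copies G (cycle_graph m)"
proof -
  have "finite (verts G)"
    using G finite_verts_hypercube[of n] by (auto simp: subgraph_def intro: finite_subset)
  then have "card (embeddings (cycle_graph m) G)
      = card (automorphisms (cycle_graph m)) * num_copies G (cycle_graph m)"
    using card_embeddings[OF simple_cycle_graph[OF m], of G "\<lambda>_. True"]
    by (simp add: num_copies_def)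
  then show ?thesis using bij_betw_same_card[OF bij_betw_walk_map[OF G m]] by simp
qed

lemma subgraph_hypercube_self: "subgraph (hypercube n) (hypercube n)"
  by (simp add: subgraph_def simple_hypercube)

lemma walk_arc_in_hypercube:
  assumes "(X, s) \<in> walks n m" "j < m"
  shows "arc n (X \<triangle> par (take j s)) (s ! j) \<in> edges (hypercube n)"
proof -
  have "s \<in> good n m" "X \<subseteq> {..<n}" using assms(1) by (auto simp: walks_def)
  then have "X \<triangle> par (take j s) \<subseteq> {..<n}" "s ! j < n"
    using goodD(6)[of s n m j] goodD(5)[OF _ assms(2)] by (simp_all add: sdiff_subset)
  then show ?thesis unfolding edges_hypercube by blast
qed

lemma walks_in_hypercube:
  "{(X, s) \<in> walks n m. \<forall>j<m. arc n (X \<triangle> par (take j s)) (s ! j) \<in> edges (hypercube n)}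
    = walks n m"
proof -
  have "{(X, s) \<in> walks n m. P X s} = walks n m" if "\<And>X s. (X, s) \<in> walks n m \<Longrightarrow> P X s" for P
    using that by blast
  then show ?thesis by (simp add: walk_arc_in_hypercube)
qed

lemma card_walks_num_copies:
  assumes m: "m \<ge> 2"
  shows "card (walks n m)
    = card (automorphisms (cycle_graph m)) * num_copies (hypercube n) (cycle_graph m)"
  using card_walks_in_subgraph[OF subgraph_hypercube_self m] by (simp only: walks_in_hypercube)

text \<open>This expresses \<open>z_{l,l}\<close> by flip sequences: every sequence may start at any
  of the \<open>2 ^ l\<close> vertices, and every cycle is traced by as many walks as it has
  automorphisms.\<close>

lemma card_good_full_cycles:
  assumes l: "l \<ge> 1"
  shows "2 ^ l * card {s \<in> good l (2 * l). set s = {..<l}}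
    = card (automorphisms (cycle_graph (2 * l))) * full_cycles l l"
proof -
  let ?C = "cycle_graph (2 * l)" and ?Q = "hypercube l"
  let ?P = "\<lambda>S. (\<Union>e\<in>edges S. flip_coords e) = {..<l}"
  let ?W = "Pow {..<l} \<times> {s \<in> good l (2 * l). set s = {..<l}}"
  have m: "2 * l \<ge> 2" using l by simp
  have bij: "bij_betw (walk_map l) (walks l (2 * l)) (embeddings ?C ?Q)"
    using bij_betw_walk_map[OF subgraph_hypercube_self m] by (simp only: walks_in_hypercube)
  have "bij_betw (walk_map l) ?W {f \<in> embeddings ?C ?Q. ?P (map_graph f ?C)}"
  proof (rule bij_betw_subset[OF bij])
    show "walk_map l ` ?W = {f \<in> embeddings ?C ?Q. ?P (map_graph f ?C)}"
    proof -
      have eq: "embeddings ?C ?Q = walk_map l ` walks l (2 * l)"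
        using bij by (simp add: bij_betw_def)
      have P: "?P (map_graph (walk_map l (X, s)) ?C) \<longleftrightarrow> set s = {..<l}"
        if "s \<in> good l (2 * l)" for X s
        by (simp only: flip_coords_walk_map[OF that m])
      show ?thesis unfolding eq
      proof (intro equalityI subsetI)
        fix f assume "f \<in> walk_map l ` ?W"
        then obtain X s where "f = walk_map l (X, s)" "X \<subseteq> {..<l}" "s \<in> good l (2 * l)" "set s = {..<l}"
          by blast
        then show "f \<in> {f \<in> walk_map l ` walks l (2 * l). ?P (map_graph f ?C)}"
          using P[of s X] unfolding walks_def by blast
      next
        fix f assume "f \<in> {f \<in> walk_map l ` walks l (2 * l). ?P (map_graph f ?C)}"
        then obtain X s where f: "f = walk_map l (X, s)" "X \<subseteq> {..<l}" "s \<in> good l (2 * l)"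
            "?P (map_graph f ?C)"
          unfolding walks_def by blast
        have "set s = {..<l}" using f(4) unfolding f(1) P[OF f(3)] .
        then show "f \<in> walk_map l ` ?W" using f by blast
      qed
    qed
  qed (auto simp: walks_def)
  then have "card ?W = card {f \<in> embeddings ?C ?Q. ?P (map_graph f ?C)}"
    by (rule bij_betw_same_card)
  also have "\<dots> = card (automorphisms ?C) * card {S \<in> copies ?Q ?C. ?P S}"
    by (rule card_embeddings[OF simple_cycle_graph[OF m] _ finite_verts_hypercube]) simp
  finally show ?thesis by (simp add: card_cartesian_product card_Pow full_cycles_def)
qed

subsection \<open>Levels\<close>

text \<open>A nonempty fibre of even size has at least two elements. This bounds both the levels and
  the flip coordinates of a closed walk.\<close>

lemma even_fibers_card_image:
  fixes f :: "nat \<Rightarrow> 'a"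
  assumes "\<And>t. even (card {j. j < m \<and> f j = t})"
  shows "2 * card (f ` {..<m}) \<le> m"
proof -
  have "2 \<le> card {j \<in> {..<m}. f j = t}" if "t \<in> f ` {..<m}" for t
  proof -
    have "card {j \<in> {..<m}. f j = t} \<noteq> 0" using that by auto
    moreover have "even (card {j \<in> {..<m}. f j = t})" using assms[of t] by simp
    ultimately show ?thesis by (cases "card {j \<in> {..<m}. f j = t}" rule: nat.exhaust) (auto elim!: oddE)
  qed
  then have "(\<Sum>t\<in>f ` {..<m}. 2) \<le> (\<Sum>t\<in>f ` {..<m}. card {j \<in> {..<m}. f j = t})"
    by (rule sum_mono)
  also have "\<dots> = m"
    using sum.image_gen[of "{..<m}" "\<lambda>_. 1::nat" f] by simp
  finally show ?thesis by simp
qed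

text \<open>The edge between \<open>X\<close> and \<open>X \<triangle> {i}\<close> joins the vertices of weight \<open>lev X i\<close>
  and \<open>lev X i + 1\<close>.\<close>

definition lev :: "nat set \<Rightarrow> nat \<Rightarrow> nat" where
  "lev X i = card (X - {i})"

lemma lev_sdiff [simp]: "lev (X \<triangle> {i}) i = lev X i"
proof -
  have "X \<triangle> {i} - {i} = X - {i}" by auto
  then show ?thesis by (simp add: lev_def)
qed

text \<open>The exclusive-or form lets the crossings of level \<open>t\<close> along a walk be
  counted modulo 2.\<close>

lemma card_sdiff_gt_iff:
  assumes "finite X"
  shows "(card (X \<triangle> {i}) > t) \<longleftrightarrow> (card X > t) \<noteq> (lev X i = t)"
proof (cases "i \<in> X")
  case True
  then have "X \<triangle> {i} = X - {i}" by auto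
  then have "card (X \<triangle> {i}) = lev X i" by (simp add: lev_def)
  moreover have "card X = Suc (lev X i)"
    unfolding lev_def using assms True by (rule card.remove)
  ultimately show ?thesis by auto
next
  case False
  then have "X \<triangle> {i} = insert i X" "X - {i} = X" by auto
  then have "card (X \<triangle> {i}) = Suc (lev X i)" "card X = lev X i"
    using assms False by (simp_all add: lev_def)
  then show ?thesis by auto
qed

text \<open>A closed walk ends on the side of each weight threshold where it began, so it uses every
  level an even number of times.\<close>

lemma walk_levels:
  assumes "(X, s) \<in> walks n m"
  shows "2 * card ((\<lambda>j. lev (X \<triangle> par (take j s)) (s ! j)) ` {..<m}) \<le> m"
proof (rule even_fibers_card_image)
  fix t
  have X: "finite X" and s: "s \<in> good n m"
    using assms by (auto simp: walks_def intro: finite_subset)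
  let ?L = "\<lambda>j. lev (X \<triangle> par (take j s)) (s ! j)"
  have fin: "finite (X \<triangle> par (take j s))" for j
    using X finite_subset[OF par_take_subset[of j s]] by simp
  \<comment> \<open>The walk crosses from weight at most \<open>t\<close> to weight above \<open>t\<close> or back exactly at the
    steps of level \<open>t\<close>.\<close>
  have "(card (X \<triangle> par (take j s)) > t) \<longleftrightarrow> (card X > t) \<noteq> odd (card {i. i < j \<and> ?L i = t})"
    if "j \<le> m" for j
    using that
  proof (induction j)
    case (Suc j)
    have "{i. i < Suc j \<and> ?L i = t}
        = (if ?L j = t then insert j {i. i < j \<and> ?L i = t} else {i. i < j \<and> ?L i = t})"
      by (auto simp: less_Suc_eq)
    then have "odd (card {i. i < Suc j \<and> ?L i = t})
        \<longleftrightarrow> odd (card {i. i < j \<and> ?L i = t}) \<noteq> (?L j = t)"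
      by auto
    moreover have "X \<triangle> par (take (Suc j) s) = X \<triangle> par (take j s) \<triangle> {s ! j}"
      using Suc.prems goodD(1)[OF s] by (simp add: par_take_Suc sdiff_assoc)
    ultimately show ?case
      using card_sdiff_gt_iff[OF fin, of t j "s ! j"] Suc by auto
  qed simp
  from this[of m] show "even (card {j. j < m \<and> ?L j = t})"
    using goodD(1,3)[OF s] by simp blast
qed

section \<open>Deleting every \<open>k\<close>-th level destroys all copies of the
  \<open>k\<close>-cube\<close>

definition layered :: "nat \<Rightarrow> nat \<Rightarrow> nat \<Rightarrow> bool list graph" where
  "layered n k a = Graph {v. length v = n}
     {arc n X i | X i. X \<subseteq> {..<n} \<and> i < n \<and> lev X i mod k \<noteq> a}"

lemma subgraph_layered: "subgraph (layered n k a) (hypercube n)"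
proof -
  have "edges (layered n k a) \<subseteq> edges (hypercube n)"
    unfolding edges_hypercube by (auto simp: layered_def)
  then show ?thesis
    using simple_hypercube[of n] by (auto simp: subgraph_def simple_graph_def layered_def)
qed

text \<open>Both representations of an edge have the same level, so membership may be tested on
  either of them.\<close>

lemma arc_in_layered:
  assumes "X \<subseteq> {..<n}" "i < n"
  shows "arc n X i \<in> edges (layered n k a) \<longleftrightarrow> lev X i mod k \<noteq> a"
proof
  assume "arc n X i \<in> edges (layered n k a)"
  then obtain Y j where "arc n X i = arc n Y j" "Y \<subseteq> {..<n}" "j < n" "lev Y j mod k \<noteq> a"
    by (auto simp: layered_def)
  then show "lev X i mod k \<noteq> a" using assms arc_eq_iff[of X n Y i j] by auto
qed (use assms in \<open>auto simp: layered_def\<close>)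

text \<open>Since two vertices of a hypercube have at most two common neighbours, an embedding of
  \<open>Q\<^sub>k\<close> is determined by its values at one vertex and its neighbours. From a vertex of least
  weight the image therefore rises through \<open>k\<close> consecutive levels.\<close>

lemma embedded_cube_levels:
  fixes F :: "nat set \<Rightarrow> nat set"
  assumes fin: "\<And>Y. Y \<subseteq> {..<k} \<Longrightarrow> finite (F Y)"
    and inj: "inj_on F (Pow {..<k})"
    and step: "\<And>Y i. Y \<subseteq> {..<k} \<Longrightarrow> i < k \<Longrightarrow> \<exists>c. F (Y \<triangle> {i}) = F Y \<triangle> {c}"
    and a: "a < k"
  obtains Y i c where "Y \<subseteq> {..<k}" "i < k" "F (Y \<triangle> {i}) = F Y \<triangle> {c}" "lev (F Y) c mod k = a"
proof -
  obtain Y0 where Y0: "Y0 \<subseteq> {..<k}" "\<And>Y. Y \<subseteq> {..<k} \<Longrightarrow> card (F Y0) \<le> card (F Y)"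
    using ex_has_least_nat[of "\<lambda>Y. Y \<subseteq> {..<k}" "{}" "\<lambda>Y. card (F Y)"] by auto
  define Z where "Z = F Y0"
  have finZ: "finite Z" using fin Y0(1) by (simp add: Z_def)
  obtain c where c: "\<And>i. i < k \<Longrightarrow> F (Y0 \<triangle> {i}) = Z \<triangle> {c i}"
    using step[OF Y0(1)] unfolding Z_def by metis
  \<comment> \<open>Flipping a coordinate of \<open>Z\<close> would lead to an image of smaller
    weight.\<close>
  have cZ: "c i \<notin> Z" if "i < k" for i
  proof
    assume "c i \<in> Z"
    then have "Z \<triangle> {c i} = Z - {c i}" by auto
    then have "card (Z \<triangle> {c i}) < card Z" using card_Diff1_less[OF finZ \<open>c i \<in> Z\<close>] by (simp only:)
    moreover have "card Z \<le> card (F (Y0 \<triangle> {i}))"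
      unfolding Z_def using that Y0(1) by (intro Y0(2) sdiff_subset) auto
    ultimately show False using c[OF that] by simp
  qed
  have injD: "A = B" if "A \<subseteq> {..<k}" "B \<subseteq> {..<k}" "F (Y0 \<triangle> A) = F (Y0 \<triangle> B)" for A B
  proof -
    have "Y0 \<triangle> A = Y0 \<triangle> B"
      using inj_onD[OF inj that(3)] that(1,2) Y0(1) by (simp add: sdiff_subset)
    then show ?thesis by simp
  qed
  have cinj: "inj_on c {..<k}"
  proof (rule inj_onI)
    fix i j assume "i \<in> {..<k}" "j \<in> {..<k}" "c i = c j"
    moreover from this have "F (Y0 \<triangle> {i}) = F (Y0 \<triangle> {j})" using c[of i] c[of j] by simp
    ultimately have "{i} = {j}" using injD[of "{i}" "{j}"] by simp
    then show "i = j" by simp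
  qed
  have main: "F (Y0 \<triangle> S) = Z \<union> c ` S" if "S \<subseteq> {..<k}" for S
    using that
  proof (induction "card S" arbitrary: S rule: less_induct)
    case less
    have finS: "finite S" using less.prems by (rule finite_subset) simp
    consider "S = {}" | i where "S = {i}" | i j where "i \<in> S" "j \<in> S" "i \<noteq> j" by blast
    then show ?case
    proof cases
      case 1
      then show ?thesis by (simp add: Z_def)
    next
      case (2 i)
      then have "i < k" using less.prems by simp
      then show ?thesis using 2 c[OF \<open>i < k\<close>] cZ by (simp add: sdiff_singleton)
    next
      case (3 i j)
      define T where "T = S - {i, j}"
      define W where "W = Z \<union> c ` T"
      have ijk: "i < k" "j < k" "T \<subseteq> {..<k}" "insert i T \<subseteq> {..<k}" "insert j T \<subseteq> {..<k}"
        using 3 less.prems by (auto simp: T_def)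
      have ST: "S = insert i (insert j T)" using 3 by (auto simp: T_def)
      have iT: "i \<notin> T" "j \<notin> T" by (auto simp: T_def)
      have ne: "c i \<notin> W" "c j \<notin> W" "c i \<noteq> c j"
        using cZ[OF ijk(1)] cZ[OF ijk(2)] ijk iT 3(3) inj_on_image_mem_iff[OF cinj _ ijk(3)]
          inj_on_eq_iff[OF cinj] by (auto simp: W_def)
      have finT: "finite T" using finS by (simp add: T_def)
      have FT: "F (Y0 \<triangle> T) = W"
        unfolding W_def using ijk iT 3(3) finT by (intro less.hyps) (auto simp: ST)
      have Fi: "F (Y0 \<triangle> insert i T) = insert (c i) W"
        using less.hyps[of "insert i T"] ijk iT 3(3) finT by (simp add: ST W_def)
      have Fj: "F (Y0 \<triangle> insert j T) = insert (c j) W"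
        using less.hyps[of "insert j T"] ijk iT 3(3) finT by (simp add: ST W_def)
      have e: "Y0 \<triangle> insert i T \<triangle> {j} = Y0 \<triangle> S" "Y0 \<triangle> insert j T \<triangle> {i} = Y0 \<triangle> S"
        using iT 3(3) by (auto simp: ST)
      \<comment> \<open>The image of \<open>S\<close> is a common neighbour of
        \<open>insert (c i) W\<close> and \<open>insert (c j) W\<close>. There are only two:
        \<open>W\<close>, which is already the image of \<open>T\<close>, and the set containing
        both \<open>c i\<close> and \<open>c j\<close>.\<close>
      obtain p where p: "F (Y0 \<triangle> S) = insert (c i) W \<triangle> {p}"
        using step[OF sdiff_subset[OF Y0(1) ijk(4)] ijk(2)] e(1) Fi by metis
      obtain q where q: "F (Y0 \<triangle> S) = insert (c j) W \<triangle> {q}"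
        using step[OF sdiff_subset[OF Y0(1) ijk(5)] ijk(1)] e(2) Fj by metis
      have "F (Y0 \<triangle> S) \<noteq> W"
      proof
        assume "F (Y0 \<triangle> S) = W"
        then have "S = T" using FT injD[OF less.prems ijk(3)] by simp
        then show False using 3 by (auto simp: T_def)
      qed
      have V1: "x \<in> F (Y0 \<triangle> S) \<longleftrightarrow> (x = c i \<or> x \<in> W) \<noteq> (x = p)" for x
        by (simp add: p)
      have V2: "x \<in> F (Y0 \<triangle> S) \<longleftrightarrow> (x = c j \<or> x \<in> W) \<noteq> (x = q)" for x
        by (simp add: q)
      have "insert (c i) W \<triangle> {c i} = W" "insert (c i) W \<triangle> {c j} = insert (c j) (insert (c i) W)"
        using ne by auto
      note W = this
      have "p \<noteq> c i" using \<open>F (Y0 \<triangle> S) \<noteq> W\<close> p W(1) by metis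
      then have "q = c i" using V1[of "c i"] V2[of "c i"] ne by simp
      then have "p = c j" using V1[of "c j"] V2[of "c j"] ne by simp
      then have "F (Y0 \<triangle> S) = insert (c j) (insert (c i) W)" using p W(2) by simp
      then show ?thesis by (simp add: ST W_def insert_commute)
    qed
  qed
  \<comment> \<open>The edge from \<open>{..<j}\<close> to \<open>{..<Suc j}\<close> is mapped to
    level \<open>card Z + j\<close>, and this \<open>j\<close> makes that level congruent to
    \<open>a\<close>. Reducing \<open>card Z\<close> modulo \<open>k\<close> first keeps the natural
    subtraction exact.\<close>
  define j where "j = (a + (k - card Z mod k)) mod k"
  have j: "j < k" using a by (simp add: j_def)
  have "(card Z + j) mod k = (card Z + (a + (k - card Z mod k))) mod k"
    by (simp add: j_def mod_add_right_eq)
  also have "card Z + (a + (k - card Z mod k)) = a + k * (card Z div k + 1)"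
  proof -
    have "card Z mod k < k" using a by simp
    moreover have "card Z = k * (card Z div k) + card Z mod k" by simp
    moreover have "k * (card Z div k + 1) = k * (card Z div k) + k" by simp
    ultimately show ?thesis by linarith
  qed
  also have "\<dots> mod k = a" using a by (simp only: mod_mult_self2 mod_less)
  finally have mod: "(card Z + j) mod k = a" .
  have sub: "{..<j} \<subseteq> {..<k}" "{..<Suc j} \<subseteq> {..<k}" using j by auto
  have "c j \<notin> c ` {..<j}" using inj_on_image_mem_iff[OF cinj _ sub(1), of j] j by simp
  then have nj: "c j \<notin> Z \<union> c ` {..<j}" using cZ[OF j] by simp
  have "F (Y0 \<triangle> {..<j} \<triangle> {j}) = F (Y0 \<triangle> {..<Suc j})"
    by (rule arg_cong[of _ _ F]) auto
  also have "\<dots> = F (Y0 \<triangle> {..<j}) \<triangle> {c j}"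
    unfolding main[OF sub(1)] main[OF sub(2)] sdiff_singleton[OF nj] by (simp add: lessThan_Suc)
  finally have F: "F (Y0 \<triangle> {..<j} \<triangle> {j}) = F (Y0 \<triangle> {..<j}) \<triangle> {c j}" .
  have "card (Z \<union> c ` {..<j}) = card Z + j"
    using finZ cZ sub(1) cinj by (subst card_Un_disjoint) (auto simp: card_image inj_on_subset)
  then have "lev (F (Y0 \<triangle> {..<j})) (c j) = card Z + j"
    unfolding main[OF sub(1)] using nj by (simp add: lev_def)
  then show ?thesis
    using that[OF sdiff_subset[OF Y0(1) sub(1)] j F] mod by simp
qed

text \<open>Read on sets of coordinates, a copy of \<open>Q_k\<close> is an injective map preserving
  adjacency. By \<open>embedded_cube_levels\<close> one of its edges lies on a deleted
  level.\<close>

lemma layered_free: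
  assumes a: "a < k"
  shows "graph_free (layered n k a) (hypercube k)"
  unfolding graph_free_def
proof
  assume "\<exists>S. subgraph S (layered n k a) \<and> graph_iso (hypercube k) S"
  then obtain S f where S: "subgraph S (layered n k a)"
    and f: "bij_betw f (verts (hypercube k)) (verts S)"
    and fe: "(\<lambda>e. f ` e) ` edges (hypercube k) = edges S"
    by (auto simp: graph_iso_def)
  define F where "F Y = dec (f (enc k Y))" for Y
  have len: "length (f (enc k Y)) = n" for Y
  proof -
    have "f (enc k Y) \<in> verts S" using f by (rule bij_betw_apply) simp
    then show ?thesis using S by (auto simp: subgraph_def layered_def)
  qed
  have F: "F Y \<subseteq> {..<n}" for Y
    unfolding F_def using len by (rule dec_subset)
  have fF: "f (enc k Y) = enc n (F Y)" for Y
    using len by (simp add: F_def)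
  have step: "\<exists>c<n. F (Y \<triangle> {i}) = F Y \<triangle> {c} \<and> lev (F Y) c mod k \<noteq> a"
    if "Y \<subseteq> {..<k}" "i < k" for Y i
  proof -
    have "arc k Y i \<in> edges (hypercube k)" unfolding edges_hypercube using that by blast
    then have "f ` arc k Y i \<in> edges (layered n k a)"
      using fe S by (auto simp: subgraph_def)
    then obtain X c where X: "X \<subseteq> {..<n}" "c < n" "lev X c mod k \<noteq> a" "f ` arc k Y i = arc n X c"
      by (auto simp: layered_def)
    then have "{enc n (F Y), enc n (F (Y \<triangle> {i}))} = {enc n X, enc n (X \<triangle> {c})}"
      by (simp add: arc_def fF)
    then have "F Y = X \<and> F (Y \<triangle> {i}) = X \<triangle> {c} \<or> F Y = X \<triangle> {c} \<and> F (Y \<triangle> {i}) = X"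
      using X F by (auto simp: doubleton_eq_iff enc_inject sdiff_subset simp del: mem_sdiff)
    then show ?thesis using X by auto
  qed
  have "inj_on F (Pow {..<k})"
  proof (rule inj_onI)
    fix X Y assume XY: "X \<in> Pow {..<k}" "Y \<in> Pow {..<k}" "F X = F Y"
    then have "f (enc k X) = f (enc k Y)" using fF by simp
    then have "enc k X = enc k Y"
      using inj_onD[OF bij_betw_imp_inj_on[OF f]] by simp
    then show "X = Y" using XY by (simp add: enc_inject)
  qed
  then obtain Y i c where Y: "Y \<subseteq> {..<k}" "i < k" "F (Y \<triangle> {i}) = F Y \<triangle> {c}" "lev (F Y) c mod k = a"
    using embedded_cube_levels[of k F a] finite_subset[OF F] step a by (metis finite_lessThan)
  then show False using step[OF Y(1,2)] by auto
qed

section \<open>The extremal number and averaging over the residues\<close>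

lemma ex_copies_ge:
  assumes "finite (verts G)" "subgraph G' G" "graph_free G' H"
  shows "num_copies G' T \<le> ex_copies G T H"
  unfolding ex_copies_def
proof (rule Max_ge)
  have "{num_copies G' T |G'. subgraph G' G \<and> graph_free G' H} \<subseteq> (\<lambda>G'. num_copies G' T) ` {S. subgraph S G}"
    by auto
  then show "finite {num_copies G' T |G'. subgraph G' G \<and> graph_free G' H}"
    using finite_subgraphs[OF assms(1)] by (meson finite_imageI finite_subset)
qed (use assms in auto)

text \<open>Since \<open>H\<close> has a vertex, the empty graph is \<open>H\<close>-free, so the
  maximum is taken over a nonempty finite set.\<close>

lemma ex_copies_attained:
  assumes "finite (verts G)" "verts H \<noteq> {}"
  obtains G' where "subgraph G' G" "graph_free G' H" "ex_copies G T H = num_copies G' T"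
proof -
  let ?M = "{num_copies G' T |G'. subgraph G' G \<and> graph_free G' H}"
  have "graph_free (Graph {} {}) H"
    using assms(2) by (auto simp: graph_free_def subgraph_def graph_iso_def bij_betw_def)
  moreover have "subgraph (Graph {} {}) G" by (simp add: subgraph_def simple_graph_def)
  ultimately have "?M \<noteq> {}" by blast
  moreover have "?M \<subseteq> (\<lambda>G'. num_copies G' T) ` {S. subgraph S G}"
    by auto
  then have "finite ?M"
    using finite_subgraphs[OF assms(1)] by (meson finite_imageI finite_subset)
  ultimately have "ex_copies G T H \<in> ?M" unfolding ex_copies_def by (intro Max_in)
  then show ?thesis using that by blast
qed

text \<open>Averaging over the \<open>k\<close> graphs \<open>layered n k a\<close>: a walk with edges on at most \<open>b\<close> levels
  survives in all but \<open>b\<close> of them.\<close>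

lemma ex_copies_lower:
  assumes m: "m \<ge> 2" and W: "W \<subseteq> walks n m"
    and b: "\<And>X s. (X, s) \<in> W \<Longrightarrow> card ((\<lambda>j. lev (X \<triangle> par (take j s)) (s ! j)) ` {..<m}) \<le> b"
  shows "(k - b) * card W \<le> k * (card (automorphisms (cycle_graph m))
    * ex_copies (hypercube n) (cycle_graph m) (hypercube k))"
proof -
  define L where "L = (\<lambda>(X, s). (\<lambda>j. lev (X \<triangle> par (take j s)) (s ! j)) ` {..<m})"
  define R where "R = (\<lambda>w a. a \<notin> (\<lambda>t. t mod k) ` L w)"
  let ?A = "card (automorphisms (cycle_graph m))"
  let ?E = "ex_copies (hypercube n) (cycle_graph m) (hypercube k)"
  have finW: "finite W" using W finite_walks by (rule finite_subset)
  have "card {w \<in> W. R w a} \<le> ?A * ?E" if a: "a < k" for a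
  proof -
    have "{w \<in> W. R w a}
        \<subseteq> {(X, s) \<in> walks n m. \<forall>j<m. arc n (X \<triangle> par (take j s)) (s ! j) \<in> edges (layered n k a)}"
    proof clarify
      fix X s assume w: "(X, s) \<in> W" "R (X, s) a"
      then have "X \<subseteq> {..<n}" "s \<in> good n m" using W by (auto simp: walks_def)
      moreover from w(2) have "\<forall>j<m. lev (X \<triangle> par (take j s)) (s ! j) mod k \<noteq> a"
        by (auto simp: R_def L_def)
      ultimately have "\<forall>j<m. arc n (X \<triangle> par (take j s)) (s ! j) \<in> edges (layered n k a)"
        using goodD(5,6)[of s n m] by (auto simp: arc_in_layered sdiff_subset simp del: mem_sdiff)
      then show "(X, s) \<in> walks n m \<and>
          (\<forall>j<m. arc n (X \<triangle> par (take j s)) (s ! j) \<in> edges (layered n k a))"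
        using w(1) W by auto
    qed
    then have "card {w \<in> W. R w a} \<le> card {(X, s) \<in> walks n m.
        \<forall>j<m. arc n (X \<triangle> par (take j s)) (s ! j) \<in> edges (layered n k a)}"
      by (rule card_mono[rotated]) (rule finite_subset[OF _ finite_walks[of n m]], auto)
    also have "\<dots> = ?A * num_copies (layered n k a) (cycle_graph m)"
      by (rule card_walks_in_subgraph[OF subgraph_layered m])
    also have "\<dots> \<le> ?A * ?E"
      by (intro mult_le_mono2 ex_copies_ge finite_verts_hypercube subgraph_layered layered_free a)
    finally show ?thesis .
  qed
  \<comment> \<open>Double counting of the pairs of a walk in \<open>W\<close> and a residue that
    none of its levels has.\<close>
  then have "(\<Sum>a<k. card {w \<in> W. R w a}) \<le> (\<Sum>a<k. ?A * ?E)" by (intro sum_mono) auto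
  moreover have "(\<Sum>a<k. card {w \<in> W. R w a}) = (\<Sum>w\<in>W. card {a \<in> {..<k}. R w a})"
    using finW by (intro sum_multicount_gen) auto
  moreover have "(\<Sum>w\<in>W. k - b) \<le> (\<Sum>w\<in>W. card {a \<in> {..<k}. R w a})"
  proof (rule sum_mono)
    fix w assume "w \<in> W"
    have fin: "finite (L w)" by (auto simp: L_def split: prod.split)
    have "card (L w) \<le> b" using b \<open>w \<in> W\<close> by (cases w) (auto simp: L_def)
    then have "card ((\<lambda>t. t mod k) ` L w) \<le> b"
      using card_image_le[OF fin, of "\<lambda>t. t mod k"] by simp
    then have "k - b \<le> card {..<k} - card ((\<lambda>t. t mod k) ` L w)" by simp
    also have "\<dots> \<le> card ({..<k} - (\<lambda>t. t mod k) ` L w)"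
      using fin by (intro diff_card_le_card_Diff) auto
    also have "{..<k} - (\<lambda>t. t mod k) ` L w = {a \<in> {..<k}. R w a}" by (auto simp: R_def)
    finally show "k - b \<le> card {a \<in> {..<k}. R w a}" .
  qed
  ultimately show ?thesis by (simp add: mult.commute)
qed

subsection \<open>Missing edges and the upper bound\<close>

lemma image_sdiff:
  assumes "inj_on h C" "A \<subseteq> C" "B \<subseteq> C"
  shows "h ` (A \<triangle> B) = h ` A \<triangle> h ` B"
proof -
  have "X \<triangle> Y = (X - Y) \<union> (Y - X)" for X Y :: "'b set" by (simp add: set_eq_iff) blast
  moreover have "A \<triangle> B = (A - B) \<union> (B - A)" by auto
  moreover have "h ` (A - B) = h ` A - h ` B" "h ` (B - A) = h ` B - h ` A"
    using assms inj_on_image_set_diff[OF assms(1), of A B] inj_on_image_set_diff[OF assms(1), of B A]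
    by blast+
  ultimately show ?thesis by (simp add: image_Un)
qed

lemma par_map:
  assumes "inj_on h C" "set s \<subseteq> C"
  shows "par (map h s) = h ` par s"
  using assms(2)
proof (induction s)
  case (Cons x s)
  then have "par s \<subseteq> C" using par_subset[of s] by auto
  then show ?case using Cons image_sdiff[OF assms(1), of "{x}" "par s"] by (simp add: par_Cons)
qed simp

text \<open>An injective relabelling maps the parity set of each prefix to its image, so distinct
  vertices of the walk stay distinct.\<close>

lemma good_map:
  assumes s: "s \<in> good n m" and h: "inj_on h (set s)" "h ` set s \<subseteq> {..<n'}"
  shows "map h s \<in> good n' m"
proof -
  note g = goodD[OF s]
  have par: "par (take j (map h s)) = h ` par (take j s)" for j
    unfolding take_map by (rule par_map[OF h(1) set_take_subset])
  have "inj_on (\<lambda>j. par (take j (map h s))) {..<m}"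
  proof (rule inj_onI)
    fix i j assume ij: "i \<in> {..<m}" "j \<in> {..<m}"
      "par (take i (map h s)) = par (take j (map h s))"
    then have "par (take i s) = par (take j s)"
      using inj_on_image_eq_iff[OF h(1)] par_take_subset[of _ s] by (simp add: par)
    then show "i = j" using g(4) ij by (auto dest: inj_onD)
  qed
  then show ?thesis
    using g(1-3) h par_map[OF h(1) order_refl] by (auto simp: good_def)
qed

text \<open>Transposing two coordinates maps flip sequences to flip sequences, so each coordinate
  comes first equally often.\<close>

lemma card_good_first:
  assumes "i < n" "m \<ge> 1"
  shows "n * card {s \<in> good n m. s ! 0 = i} = card (good n m)"
proof -
  define g where "g i = {s \<in> good n m. s ! 0 = i}" for i
  have fin: "finite (g i)" for i unfolding g_def using finite_good[of n m] by simp
  have le: "card (g i) \<le> card (g j)" if "i < n" "j < n" for i j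
  proof -
    define h where "h x = (if x = i then j else if x = j then i else x)" for x
    have hh: "h (h x) = x" for x by (auto simp: h_def)
    have h: "inj_on h A" for A by (metis hh inj_onI)
    have "inj_on (map h) (g i)"
      using h by (auto intro!: inj_onI dest: map_inj_on)
    moreover have "map h s \<in> g j" if s: "s \<in> g i" for s
    proof -
      have "h ` set s \<subseteq> {..<n}"
        using goodD(2)[of s n m] s \<open>i < n\<close> \<open>j < n\<close> by (auto simp: h_def g_def)
      then have "map h s \<in> good n m" using s h good_map[of s n m h n] by (simp add: g_def)
      moreover have "map h s ! 0 = j"
        using s goodD(1)[of s n m] assms(2) by (simp add: g_def h_def)
      ultimately show ?thesis by (simp add: g_def)
    qed
    ultimately show ?thesis using card_inj_on_le[of "map h" "g i" "g j"] fin by blast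
  qed
  have "good n m = (\<Union>j<n. g j)"
    using goodD(5)[of _ n m 0] assms(2) by (auto simp: g_def)
  then have "card (good n m) = (\<Sum>j<n. card (g j))"
    using fin by (simp only:) (rule card_UN_disjoint, auto simp: g_def)
  also have "\<dots> = (\<Sum>j<n. card (g i))"
    using le assms(1) by (intro sum.cong) (auto intro: le_antisym)
  finally show ?thesis by (simp add: g_def)
qed

section \<open>Missing edges of a graph without \<open>k\<close>-cubes\<close>

text \<open>Every missing edge occurs twice, once for each endpoint, which matches a walk's choice
  of start and first flip.\<close>

definition missing :: "nat \<Rightarrow> bool list graph \<Rightarrow> (nat set \<times> nat) set" where
  "missing n G = {(X, i). X \<subseteq> {..<n} \<and> i < n \<and> arc n X i \<notin> edges G}"

lemma finite_missing: "finite (missing n G)"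
  by (rule finite_subset[of _ "Pow {..<n} \<times> {..<n}"]) (auto simp: missing_def)

text \<open>By symmetry the first edge of a random walk is a uniformly random edge, so at least
  the fraction of missing edges is lost among the cycles.\<close>

lemma num_copies_missing:
  assumes G: "subgraph G (hypercube n)" and m: "m \<ge> 2"
  shows "n * (card (automorphisms (cycle_graph m)) * num_copies G (cycle_graph m))
    + card (missing n G) * card (good n m) \<le> n * card (walks n m)"
proof (cases "n = 0")
  case False
  \<comment> \<open>Walks with a missing first edge. They are disjoint from the surviving walks
    \<open>W\<close>, and \<open>card_good_first\<close> determines their number.\<close>
  define B where "B = {(X, s) \<in> walks n m. (X, s ! 0) \<in> missing n G}"
  define W where "W = {(X, s) \<in> walks n m.
    \<forall>j<m. arc n (X \<triangle> par (take j s)) (s ! j) \<in> edges G}"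
  define A where "A = (SIGMA (X, i) : missing n G. {s \<in> good n m. s ! 0 = i})"
  have "bij_betw (\<lambda>((X, i), s). (X, s)) A B"
    by (rule bij_betwI[where g = "\<lambda>(X, s). ((X, s ! 0), s)"])
       (auto simp: A_def B_def walks_def missing_def)
  then have "card B = card A" by (simp add: bij_betw_same_card)
  also have "\<dots> = (\<Sum>(X, i)\<in>missing n G. card {s \<in> good n m. s ! 0 = i})"
    unfolding A_def using finite_missing[of n G] finite_good[of n m]
    by (subst card_SigmaI) (auto simp: case_prod_beta)
  finally have "n * card B = (\<Sum>(X, i)\<in>missing n G. n * card {s \<in> good n m. s ! 0 = i})"
    by (simp add: sum_distrib_left case_prod_beta)
  also have "\<dots> = (\<Sum>(X, i)\<in>missing n G. card (good n m))"
    using card_good_first[of _ n m] m by (intro sum.cong) (auto simp: missing_def)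
  finally have B: "n * card B = card (missing n G) * card (good n m)" by simp
  have "W \<inter> B = {}" using m by (auto simp: W_def B_def missing_def dest: spec[of _ 0])
  moreover have sub: "W \<union> B \<subseteq> walks n m" by (auto simp: W_def B_def)
  moreover have "finite W" "finite B"
    using sub finite_subset[OF _ finite_walks[of n m]] by auto
  ultimately have "card W + card B \<le> card (walks n m)"
    using card_mono[OF finite_walks sub] by (simp add: card_Un_disjoint)
  then have "n * card W + n * card B \<le> n * card (walks n m)"
    by (metis add_mult_distrib2 mult_le_mono2)
  then show ?thesis using card_walks_in_subgraph[OF G m] B by (simp add: W_def)
qed (auto simp: missing_def)

text \<open>If all edges in the directions \<open>D\<close> of the subcube through \<open>X\<close>
  were present, a bijection from \<open>{..<k}\<close> to \<open>D\<close> would embed the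
  \<open>k\<close>-cube in \<open>G\<close>.\<close>

lemma missing_in_subcube:
  assumes G: "subgraph G (hypercube n)" "graph_free G (hypercube k)" and k: "k \<ge> 1"
    and D: "D \<subseteq> {..<n}" "card D = k" and X: "X \<subseteq> {..<n}"
  shows "\<exists>(Y, i) \<in> missing n G. Y - D = X - D \<and> i \<in> D"
proof (rule ccontr)
  assume contr: "\<not> ?thesis"
  then have pres: "arc n Y i \<in> edges G" if "Y \<subseteq> {..<n}" "Y - D = X - D" "i \<in> D" for Y i
  proof -
    have "(Y, i) \<notin> missing n G" using contr that(2,3) by blast
    moreover have "i < n" using that(3) D(1) by blast
    ultimately show ?thesis using that(1) by (simp add: missing_def)
  qed
  have "finite D" using D(1) by (rule finite_subset) simp
  then obtain h where h: "bij_betw h {..<k} D"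
    using D(2) ex_bij_betw_nat_finite[of D] by (auto simp: atLeast0LessThan)
  then have hinj: "inj_on h {..<k}" and hD: "h ` {..<k} = D" by (auto simp: bij_betw_def)
  define E where "E Z = (X - D) \<union> h ` Z" for Z
  define f where "f = restrict (\<lambda>v. enc n (E (dec v))) (verts (hypercube k))"
  have f: "f (enc k Z) = enc n (E Z)" if "Z \<subseteq> {..<k}" for Z
    using that by (simp add: f_def)
  have hZ: "h ` Z \<subseteq> D" if "Z \<subseteq> {..<k}" for Z using that hD by auto
  have E: "E Z \<subseteq> {..<n}" "E Z - D = X - D" "E Z \<inter> D = h ` Z" if "Z \<subseteq> {..<k}" for Z
    using hZ[OF that] D(1) X by (auto simp: E_def)
  have arc: "f ` arc k Z i = arc n (E Z) (h i)" "f ` arc k Z i \<in> edges G"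
    if "Z \<subseteq> {..<k}" "i < k" for Z i
  proof -
    have hi: "h i \<in> D" using that(2) hD by auto
    have Zi: "Z \<triangle> {i} \<subseteq> {..<k}" using that by (simp add: sdiff_subset)
    have "h ` (Z \<triangle> {i}) = h ` Z \<triangle> {h i}"
      using image_sdiff[OF hinj that(1), of "{i}"] that(2) by simp
    then have "E (Z \<triangle> {i}) = E Z \<triangle> {h i}" using hi by (auto simp: E_def)
    then show "f ` arc k Z i = arc n (E Z) (h i)"
      using f[OF that(1)] f[OF Zi] by (simp add: arc_def)
    then show "f ` arc k Z i \<in> edges G"
      using pres[OF E(1,2)[OF that(1)] hi] by simp
  qed
  have "f \<in> embeddings (hypercube k) G"
    unfolding embeddings_def
  proof (intro CollectI conjI)
    show "inj_on f (verts (hypercube k))"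
    proof (rule inj_onI)
      fix u v assume uv: "u \<in> verts (hypercube k)" "v \<in> verts (hypercube k)" "f u = f v"
      then have d: "dec u \<subseteq> {..<k}" "dec v \<subseteq> {..<k}" by (simp_all add: dec_subset)
      then have "enc n (E (dec u)) = enc n (E (dec v))"
        using f[of "dec u"] f[of "dec v"] uv by simp
      then have "E (dec u) = E (dec v)" using enc_inject[OF E(1)[OF d(1)] E(1)[OF d(2)]] by simp
      then have "h ` dec u = h ` dec v" using E(3)[OF d(1)] E(3)[OF d(2)] by simp
      then have "dec u = dec v" using inj_on_image_eq_iff[OF hinj d] by simp
      moreover have "enc k (dec u) = u" "enc k (dec v) = v" using uv(1,2) by simp_all
      ultimately show "u = v" by metis
    qed
    show "f ` verts (hypercube k) \<subseteq> verts G"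
    proof
      fix w assume "w \<in> f ` verts (hypercube k)"
      then obtain v where v: "w = f v" "length v = k" by auto
      \<comment> \<open>As \<open>k \<ge> 1\<close>, each vertex lies on an edge in direction 0, and
        the image of this edge is in \<open>G\<close>; so the image of the vertex is in
        \<open>G\<close> too.\<close>
      have "f ` arc k (dec v) 0 \<in> edges G" using arc(2)[of "dec v" 0] v(2) k by (simp add: dec_subset)
      moreover have "v \<in> arc k (dec v) 0" using v(2) by (simp add: arc_def)
      ultimately have "f v \<in> \<Union> (edges G)" by blast
      then show "w \<in> verts G"
        using G(1) v(1) by (auto simp: subgraph_def simple_graph_def)
    qed
    show "(\<lambda>e. f ` e) ` edges (hypercube k) \<subseteq> edges G"
      unfolding edges_hypercube using arc(2) by blast
  qed (simp add: f_def)
  then have "map_graph f (hypercube k) \<in> copies G (hypercube k)"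
    by (rule map_graph_in_copies[OF simple_hypercube])
  then show False using G(2) by (auto simp: copies_def graph_free_def)
qed

text \<open>In a subcube of dimension \<open>k + 2\<close> each coordinate is a function from the missing edges to
  \<open>{0, 1, flip}\<close>. These functions are distinct, because for coordinates \<open>c \<noteq> c'\<close> the
  \<open>k\<close>-dimensional subcube with \<open>c\<close> fixed to 0 and \<open>c'\<close> to 1 has a missing edge.\<close>

lemma missing_edges_log:
  assumes G: "subgraph G (hypercube n)" "graph_free G (hypercube k)" and k: "k \<ge> 1"
    and D: "D \<subseteq> {..<n}" "card D = k + 2" and X: "X \<subseteq> {..<n}"
  shows "k + 2 \<le> 3 ^ card {(Y, i) \<in> missing n G. Y - D = X - D \<and> i \<in> D}"
proof -
  define R where "R = {(Y, i) \<in> missing n G. Y - D = X - D \<and> i \<in> D}"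
  have finR: "finite R" unfolding R_def by (rule finite_subset[OF _ finite_missing[of n G]]) auto
  have finD: "finite D" using D(1) by (rule finite_subset) simp
  define code where
    "code c = restrict (\<lambda>(Y, i). if i = c then 2 else if c \<in> Y then 1 else 0 :: nat) R" for c
  have "inj_on code D"
  proof (rule inj_onI, rule ccontr)
    fix c c' assume c: "c \<in> D" "c' \<in> D" "code c = code c'" "c \<noteq> c'"
    \<comment> \<open>The subcube in the directions \<open>D - {c, c'}\<close> through
      \<open>insert c' (X - {c})\<close> has \<open>c\<close> fixed to 0 and \<open>c'\<close> to 1.
      At its missing edge the two codes differ.\<close>
    have "card (D - {c, c'}) = k" using c D(2) finD by (simp add: card_Diff_subset)
    moreover have "D - {c, c'} \<subseteq> {..<n}" "insert c' (X - {c}) \<subseteq> {..<n}" using c D(1) X by auto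
    ultimately obtain Y i where Y: "(Y, i) \<in> missing n G" "i \<in> D - {c, c'}"
        "Y - (D - {c, c'}) = insert c' (X - {c}) - (D - {c, c'})"
      using missing_in_subcube[OF G k, of "D - {c, c'}" "insert c' (X - {c})"] by auto
    have mem: "x \<in> Y \<longleftrightarrow> x = c' \<or> x \<in> X \<and> x \<noteq> c" if "x \<notin> D - {c, c'}" for x
      using Y(3) that by blast
    have "Y - D = X - D" using mem c by auto
    then have "(Y, i) \<in> R" using Y by (simp add: R_def)
    moreover have "c \<notin> Y" "c' \<in> Y" using mem[of c] mem[of c'] c(4) by auto
    ultimately show False using fun_cong[OF c(3), of "(Y, i)"] Y(2) by (simp add: code_def)
  qed
  moreover have "code ` D \<subseteq> R \<rightarrow>\<^sub>E {..<3}" by (auto simp: code_def)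
  ultimately have "card D \<le> card (R \<rightarrow>\<^sub>E {..<3::nat})"
    using finR by (intro card_inj_on_le[of code]) (auto intro: finite_PiE)
  then show ?thesis using finR D(2) by (simp add: card_funcsetE R_def)
qed

text \<open>The coordinates are cut into \<open>n div (k + 2)\<close> disjoint blocks. A pair
  \<open>(b, X)\<close> stands for the subcube through \<open>X\<close> spanned by block
  \<open>b\<close>, and \<open>missing_edges_log\<close> applies to it. Double counting against the
  missing pairs gives the bound.\<close>

lemma card_missing_lower:
  assumes G: "subgraph G (hypercube n)" "graph_free G (hypercube k)" and k: "k \<ge> 1"
  shows "real (n div (k + 2)) * 2 ^ n * ln (real (k + 2)) \<le> ln 3 * 2 ^ (k + 2) * real (card (missing n G))"
proof -
  define M where "M = k + 2"
  define D where "D b = {b * M..<b * M + M}" for b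
  define I where "I = {..<n div M} \<times> Pow {..<n}"
  define Q where "Q = (\<lambda>(b, X) (Y, i). Y - D b = X - D b \<and> i \<in> D b)"
  have finI: "finite I" by (simp add: I_def)
  have lower: "ln (real M) \<le> ln 3 * real (card {r \<in> missing n G. Q p r})" if "p \<in> I" for p
  proof -
    obtain b X where p: "p = (b, X)" "b < n div M" "X \<subseteq> {..<n}" using \<open>p \<in> I\<close> by (auto simp: I_def)
    have "(b + 1) * M \<le> n div M * M" using p(2) by (intro mult_le_mono1) simp
    also have "\<dots> \<le> n" by simp
    finally have "D b \<subseteq> {..<n}" by (auto simp: D_def)
    moreover have "card (D b) = k + 2" by (simp add: D_def M_def)
    moreover have "{r \<in> missing n G. Q p r}
        = {(Y, i) \<in> missing n G. Y - D b = X - D b \<and> i \<in> D b}"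
      by (auto simp: Q_def p)
    ultimately have "M \<le> 3 ^ card {r \<in> missing n G. Q p r}"
      using missing_edges_log[OF G k _ _ p(3), of "D b"] by (simp add: M_def)
    then have "real M \<le> 3 ^ card {r \<in> missing n G. Q p r}"
      by (metis of_nat_le_iff of_nat_numeral of_nat_power)
    then have "ln (real M) \<le> ln (3 ^ card {r \<in> missing n G. Q p r})"
      by (subst ln_le_cancel_iff) (auto simp: M_def)
    then show ?thesis by (simp add: ln_realpow mult.commute)
  qed
  \<comment> \<open>The block is determined by \<open>i\<close>, and \<open>X\<close> agrees with
    \<open>Y\<close> outside it, which leaves \<open>2 ^ M\<close> choices.\<close>
  have upper: "card {p \<in> I. Q p r} \<le> 2 ^ M" if "r \<in> missing n G" for r
  proof -
    obtain Y i where r: "r = (Y, i)" by (cases r)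
    let ?D = "D (i div M)"
    have "{p \<in> I. Q p r} \<subseteq> (\<lambda>Z. (i div M, (Y - ?D) \<union> Z)) ` Pow ?D"
    proof
      fix p assume "p \<in> {p \<in> I. Q p r}"
      then obtain b X where p: "p = (b, X)" "Y - D b = X - D b" "i \<in> D b" by (auto simp: I_def Q_def r)
      have "b = i div M"
        using p(3) by (auto simp: D_def algebra_simps intro!: div_nat_eqI[symmetric])
      then show "p \<in> (\<lambda>Z. (i div M, (Y - ?D) \<union> Z)) ` Pow ?D"
        using p by (intro image_eqI[of _ _ "X \<inter> ?D"]) auto
    qed
    moreover have "finite (Pow ?D)" by (simp add: D_def)
    ultimately have "card {p \<in> I. Q p r} \<le> card (Pow ?D)" by (rule surj_card_le[rotated])
    then show ?thesis by (simp add: card_Pow D_def)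
  qed
  have "real (n div M) * 2 ^ n * ln (real M) = (\<Sum>p\<in>I. ln (real M))"
    by (simp add: I_def card_cartesian_product card_Pow)
  also have "\<dots> \<le> (\<Sum>p\<in>I. ln 3 * real (card {r \<in> missing n G. Q p r}))"
    by (rule sum_mono) (rule lower)
  also have "\<dots> = ln 3 * real (\<Sum>p\<in>I. card {r \<in> missing n G. Q p r})"
    by (simp add: sum_distrib_left)
  also have "(\<Sum>p\<in>I. card {r \<in> missing n G. Q p r}) = (\<Sum>r\<in>missing n G. card {p \<in> I. Q p r})"
    using finI finite_missing by (intro sum_multicount_gen) auto
  also have "ln 3 * real \<dots> \<le> ln 3 * real (\<Sum>r\<in>missing n G. 2 ^ M)"
    by (intro mult_left_mono of_nat_mono sum_mono upper) auto
  finally show ?thesis by (simp add: M_def mult_ac)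
qed

text \<open>The proportion of lost cycles is at least the proportion \<open>\<delta>\<close> of
  missing edges, which \<open>card_missing_lower\<close> bounds from below.\<close>

lemma copy_density_upper:
  assumes k: "k \<ge> 2" and m: "m \<ge> 2" and n: "n \<ge> k + 2"
    and N: "num_copies (hypercube n) (cycle_graph m) > 0"
  shows "copy_density (hypercube n) (cycle_graph m) (hypercube k)
    \<le> 1 - 1 / 32 * (ln (real k) / (real k * 2 ^ k))"
proof -
  have "verts (hypercube k) \<noteq> {}" using Ex_list_of_length[of k] by auto
  then obtain G where G: "subgraph G (hypercube n)" "graph_free G (hypercube k)"
    and ex: "ex_copies (hypercube n) (cycle_graph m) (hypercube k) = num_copies G (cycle_graph m)"
    using ex_copies_attained[OF finite_verts_hypercube] by metis
  define A where "A = real (card (automorphisms (cycle_graph m)))"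
  define N where "N = real (num_copies (hypercube n) (cycle_graph m))"
  define E where "E = real (num_copies G (cycle_graph m))"
  define R where "R = real (card (missing n G))"
  define g where "g = real (card (good n m))"
  have A: "A > 0" unfolding A_def
    using card_automorphisms_pos[OF simple_cycle_graph[OF m]] by simp
  have "real (n * (card (automorphisms (cycle_graph m)) * num_copies G (cycle_graph m))
      + card (missing n G) * card (good n m)) \<le> real (n * card (walks n m))"
    using num_copies_missing[OF G(1) m] by (rule of_nat_mono)
  then have 1: "real n * (A * E) + R * g \<le> real n * (A * N)"
    using card_walks_num_copies[OF m, of n] by (simp add: A_def N_def E_def R_def g_def)
  have "real (card (walks n m)) = real (2 ^ n * card (good n m))" by (simp only: card_walks)
  then have 2: "A * N = 2 ^ n * g"
    using card_walks_num_copies[OF m, of n] by (simp add: A_def N_def g_def)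
  have n0: "real n > 0" using n by simp
  have N0: "N > 0" using N by (simp add: N_def)
  define \<delta> where "\<delta> = R / (real n * 2 ^ n)"
  have Rd: "R = \<delta> * (real n * 2 ^ n)" using n0 by (simp add: \<delta>_def)
  have "R * g = \<delta> * real n * (A * N)" unfolding Rd 2 by simp
  then have "real n * A * E \<le> real n * A * (N * (1 - \<delta>))" using 1 by (simp add: algebra_simps)
  then have "E \<le> N * (1 - \<delta>)" using n0 A by simp
  then have dens: "copy_density (hypercube n) (cycle_graph m) (hypercube k) \<le> 1 - \<delta>"
    using N0 by (simp add: copy_density_def ex E_def[symmetric] N_def[symmetric] field_simps)
  define M where "M = real (k + 2)"
  have M: "M \<ge> 4" "M \<le> 2 * real k" using k by (simp_all add: M_def)
  have "n < (n div (k + 2) + 1) * (k + 2)"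
    using dividend_less_div_times[of "k + 2" n] by simp
  then have "real n < real ((n div (k + 2) + 1) * (k + 2))" by (simp only: of_nat_less_iff)
  then have "real n < (real (n div (k + 2)) + 1) * M"
    unfolding M_def of_nat_mult of_nat_add of_nat_1 .
  \<comment> \<open>Since the quotient is at least 1, rounding it down costs at most a factor
    2.\<close>
  moreover have "real (n div (k + 2)) \<ge> 1" using n by (simp add: div_greater_zero_iff Suc_le_eq)
  then have "(real (n div (k + 2)) + 1) * M \<le> (2 * real (n div (k + 2))) * M"
    using M by (intro mult_right_mono) auto
  ultimately have nd: "real n \<le> 2 * M * real (n div (k + 2))" by (simp add: mult_ac)
  have ln3: "0 < ln (3::real)" "ln (3::real) \<le> 2" using ln_le_minus_one[of "3::real"] by auto
  have lnM: "0 \<le> ln (real k)" "ln (real k) \<le> ln M" using k by (simp_all add: M_def)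
  have "real n * 2 ^ n * ln M \<le> (2 * M * real (n div (k + 2))) * 2 ^ n * ln M"
    using nd lnM by (intro mult_right_mono) auto
  also have "\<dots> = 2 * M * (real (n div (k + 2)) * 2 ^ n * ln M)" by simp
  also have "\<dots> \<le> 2 * M * (ln 3 * 2 ^ (k + 2) * R)"
    using card_missing_lower[OF G] k M unfolding M_def R_def by (intro mult_left_mono) auto
  also have "\<dots> = (8 * M * 2 ^ k * ln 3) * \<delta> * (real n * 2 ^ n)" by (simp add: Rd)
  finally have "ln M * (real n * 2 ^ n) \<le> (8 * M * 2 ^ k * ln 3) * \<delta> * (real n * 2 ^ n)"
    by (simp add: mult_ac)
  then have 3: "ln M \<le> (8 * M * 2 ^ k * ln 3) * \<delta>" using n0 by simp
  have "\<delta> \<ge> 0" by (simp add: \<delta>_def R_def)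
  \<comment> \<open>With \<open>M \<le> 2 * k\<close> and \<open>ln 3 \<le> 2\<close> the factor
    becomes \<open>32 * k * 2 ^ k\<close>, whence the constant \<open>1 / 32\<close>.\<close>
  have "8 * M * 2 ^ k * ln 3 \<le> 8 * (2 * real k) * 2 ^ k * 2"
    using M ln3 by (intro mult_mono) auto
  then have "(8 * M * 2 ^ k * ln 3) * \<delta> \<le> (8 * (2 * real k) * 2 ^ k * 2) * \<delta>"
    using \<open>\<delta> \<ge> 0\<close> by (rule mult_right_mono)
  then have "ln (real k) \<le> 32 * (real k * 2 ^ k) * \<delta>" using 3 lnM by (simp add: mult_ac)
  then have "1 / 32 * (ln (real k) / (real k * 2 ^ k)) \<le> \<delta>"
    using k by (simp add: field_simps)
  then show ?thesis using dens by simp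
qed

subsection \<open>Counting flip sequences\<close>

text \<open>Makes the denominator of the density positive.\<close>

lemma num_copies_hypercube_cycle_pos:
  assumes l: "l \<ge> 2" and n: "n \<ge> l"
  shows "num_copies (hypercube n) (cycle_graph (2 * l)) > 0"
proof -
  \<comment> \<open>This walk adds the coordinates \<open>0, ..., l - 1\<close> one by one and then
    removes them in the same order.\<close>
  define s where "s = [0..<l] @ [0..<l]"
  have par0: "par [0..<j] = {..<j}" for j
    by (induction j) (simp_all add: par_append par_Cons sdiff_singleton lessThan_Suc)
  have p1: "par (take j s) = {..<j}" if "j \<le> l" for j
    using that by (simp add: s_def par0)
  have p2: "par (take (l + j) s) = {j..<l}" if "j \<le> l" for j
    using that by (auto simp: s_def par_append par0)
  have "inj_on (\<lambda>j. par (take j s)) {..<2 * l}"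
  proof (rule inj_onI)
    fix i j assume ij: "i \<in> {..<2 * l}" "j \<in> {..<2 * l}" "par (take i s) = par (take j s)"
    have p: "par (take i s) = (if i \<le> l then {..<i} else {i - l..<l})" if "i \<in> {..<2 * l}" for i
      using p1[of i] p2[of "i - l"] that by auto
    \<comment> \<open>Membership of 0 and of \<open>l - 1\<close> separates the ascending half from
      the descending one; the cardinality then gives the position.\<close>
    have "0 \<in> par (take i s) \<longleftrightarrow> 0 < i \<and> i \<le> l" "l - 1 \<in> par (take i s) \<longleftrightarrow> l \<le> i"
      if "i \<in> {..<2 * l}" for i
      using p[OF that] that l by auto
    note q = this[OF ij(1)] this[OF ij(2)]
    have "card (par (take i s)) = (if i \<le> l then i else 2 * l - i)" if "i \<in> {..<2 * l}" for i
      using p[OF that] by auto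
    note c = this[OF ij(1)] this[OF ij(2)]
    have "(0 < i \<and> i \<le> l) = (0 < j \<and> j \<le> l)" "(l \<le> i) = (l \<le> j)"
      using q unfolding ij(3) by simp_all
    moreover have "(if i \<le> l then i else 2 * l - i) = (if j \<le> l then j else 2 * l - j)"
      using c unfolding ij(3) by simp
    ultimately show "i = j" using ij(1,2) by (auto split: if_splits)
  qed
  moreover have "par s = {}" using p2[of l] by (simp add: s_def)
  moreover have "length s = 2 * l" "set s \<subseteq> {..<n}" using n by (auto simp: s_def)
  ultimately have "s \<in> good n (2 * l)" by (simp add: good_def)
  then have "card (good n (2 * l)) > 0" using finite_good by (auto simp: card_gt_0_iff)
  then have "card (walks n (2 * l)) > 0" by (simp add: card_walks)
  then show ?thesis using card_walks_num_copies[of "2 * l" n] l by simp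
qed

section \<open>Flip sequences sorted by the coordinates they use\<close>

lemma count_list_conv_card: "count_list s x = card {j. j < length s \<and> s ! j = x}"
proof (induction s)
  case (Cons y s)
  have "{j. j < length (y # s) \<and> (y # s) ! j = x}
      = (if y = x then {0} else {}) \<union> Suc ` {j. j < length s \<and> s ! j = x}"
    by (auto simp: image_iff less_Suc_eq_0_disj)
  then show ?case using Cons by (auto simp: card_image)
qed simp

text \<open>Each coordinate is flipped an even number of times, hence at least twice if at
  all.\<close>

lemma card_set_good:
  assumes "s \<in> good n (2 * l)"
  shows "card (set s) \<le> l"
proof -
  note g = goodD[OF assms]
  have "even (count_list s t)" for t using g(3) by (auto simp: par_def)
  then have "even (card {j. j < 2 * l \<and> s ! j = t})" for t
    unfolding count_list_conv_card g(1) .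
  then have "2 * card ((!) s ` {..<2 * l}) \<le> 2 * l" by (rule even_fibers_card_image)
  moreover have "(!) s ` {..<2 * l} = set s" using g(1) by (auto simp: set_conv_nth)
  ultimately show ?thesis by simp
qed

lemma card_good_with_set:
  assumes F: "F \<subseteq> {..<n}" "card F = l"
  shows "card {s \<in> good n m. set s = F} \<le> card {s \<in> good l m. set s = {..<l}}"
proof -
  have "finite F" using F(1) by (rule finite_subset) simp
  then obtain h where h: "bij_betw h F {..<l}"
    using F(2) ex_bij_betw_finite_nat[of F] by (auto simp: atLeast0LessThan)
  show ?thesis
  proof (rule card_inj_on_le[of "map h"])
    show "inj_on (map h) {s \<in> good n m. set s = F}"
    proof (rule inj_onI)
      fix s t assume st: "s \<in> {s \<in> good n m. set s = F}" "t \<in> {s \<in> good n m. set s = F}"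
      assume "map h s = map h t"
      moreover have "inj_on h (set s \<union> set t)" using h st by (simp add: bij_betw_def)
      ultimately show "s = t" by (rule map_inj_on)
    qed
    show "map h ` {s \<in> good n m. set s = F} \<subseteq> {s \<in> good l m. set s = {..<l}}"
      using h by (auto simp: bij_betw_def intro!: good_map)
    show "finite {s \<in> good l m. set s = {..<l}}" using finite_good[of l m] by simp
  qed
qed

text \<open>Such a list is given by a table of \<open>d\<close> values together with
  \<open>m\<close> indices into the table.\<close>

lemma card_lists_few_values:
  assumes "d \<ge> 1" "m \<ge> 1"
  shows "card {s :: nat list. length s = m \<and> set s \<subseteq> {..<n} \<and> card (set s) \<le> d} \<le> n ^ d * d ^ m"
proof -
  define A where "A = {g :: nat list. set g \<subseteq> {..<n} \<and> length g = d}"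
  define B where "B = {h :: nat list. set h \<subseteq> {..<d} \<and> length h = m}"
  have fin: "finite (A \<times> B)" by (simp add: A_def B_def finite_lists_length_eq)
  have "{s :: nat list. length s = m \<and> set s \<subseteq> {..<n} \<and> card (set s) \<le> d}
      \<subseteq> (\<lambda>(g, h). map ((!) g) h) ` (A \<times> B)"
  proof clarify
    fix s :: "nat list" assume s: "m = length s" "set s \<subseteq> {..<n}" "card (set s) \<le> d"
    \<comment> \<open>The sorted values are padded with an entry of \<open>s\<close>, so that the
      table has length exactly \<open>d\<close>.\<close>
    define g where "g = sorted_list_of_set (set s) @ replicate (d - card (set s)) (s ! 0)"
    have "s ! 0 \<in> set s" using s(1) assms(2) by (cases s) auto
    then have sg: "set g = set s" by (auto simp: g_def)
    have g: "g \<in> A" using s \<open>s ! 0 \<in> set s\<close> by (auto simp: A_def g_def)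
    have "\<exists>i<d. g ! i = x" if "x \<in> set s" for x
    proof -
      have "x \<in> set g" "length g = d" using that sg g by (simp_all add: A_def)
      then show ?thesis by (auto simp: in_set_conv_nth)
    qed
    then obtain p where p: "\<And>x. x \<in> set s \<Longrightarrow> p x < d \<and> g ! p x = x" by metis
    have "s = map ((!) g) (map p s)" using p by (simp add: map_idI)
    moreover have "map p s \<in> B" using p s(1) by (auto simp: B_def)
    ultimately show "s \<in> (\<lambda>(g, h). map ((!) g) h) ` (A \<times> B)"
      using g by (intro image_eqI[of _ _ "(g, map p s)"]) auto
  qed
  then have "card {s :: nat list. length s = m \<and> set s \<subseteq> {..<n} \<and> card (set s) \<le> d} \<le> card (A \<times> B)"
    using fin by (rule surj_card_le[rotated])
  also have "\<dots> = n ^ d * d ^ m"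
    by (simp add: card_cartesian_product A_def B_def card_lists_length_eq)
  finally show ?thesis .
qed

text \<open>Sequences on exactly \<open>l\<close> coordinates are grouped by their coordinate set
  and relabelled. All others use at most \<open>l - 1\<close> coordinates, so their number has lower
  order in \<open>n\<close>.\<close>

lemma card_good_upper:
  assumes l: "l \<ge> 2"
  shows "card (good n (2 * l))
    \<le> (n choose l) * card {s \<in> good l (2 * l). set s = {..<l}} + n ^ (l - 1) * (l - 1) ^ (2 * l)"
proof -
  define \<F> where "\<F> = {F. F \<subseteq> {..<n} \<and> card F = l}"
  define R where "R = {s :: nat list. length s = 2 * l \<and> set s \<subseteq> {..<n} \<and> card (set s) \<le> l - 1}"
  have "finite \<F>" by (rule finite_subset[of _ "Pow {..<n}"]) (auto simp: \<F>_def)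
  have finR: "finite R"
    by (rule finite_subset[OF _ finite_lists_length_eq[of "{..<n}" "2 * l"]]) (auto simp: R_def)
  have fin: "finite (\<Union>F\<in>\<F>. {s \<in> good n (2 * l). set s = F})"
    by (rule finite_subset[OF _ finite_good[of n "2 * l"]]) auto
  have "good n (2 * l) \<subseteq> (\<Union>F\<in>\<F>. {s \<in> good n (2 * l). set s = F}) \<union> R"
  proof
    fix s assume s: "s \<in> good n (2 * l)"
    then have "card (set s) \<le> l" by (rule card_set_good)
    then have "card (set s) = l \<or> card (set s) \<le> l - 1" by linarith
    then show "s \<in> (\<Union>F\<in>\<F>. {s \<in> good n (2 * l). set s = F}) \<union> R"
      using s goodD(1,2)[OF s] by (auto simp: \<F>_def R_def)
  qed
  then have "card (good n (2 * l)) \<le> card ((\<Union>F\<in>\<F>. {s \<in> good n (2 * l). set s = F}) \<union> R)"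
    using fin finR by (intro card_mono) auto
  also have "\<dots> \<le> card (\<Union>F\<in>\<F>. {s \<in> good n (2 * l). set s = F}) + card R"
    by (rule card_Un_le)
  also have "\<dots> \<le> (\<Sum>F\<in>\<F>. card {s \<in> good n (2 * l). set s = F}) + card R"
    using card_UN_le[OF \<open>finite \<F>\<close>] by (rule add_right_mono)
  also have "\<dots> \<le> (\<Sum>F\<in>\<F>. card {s \<in> good l (2 * l). set s = {..<l}}) + n ^ (l - 1) * (l - 1) ^ (2 * l)"
    unfolding R_def using l
    by (intro add_mono sum_mono card_lists_few_values card_good_with_set) (auto simp: \<F>_def)
  also have "(\<Sum>F\<in>\<F>. card {s \<in> good l (2 * l). set s = {..<l}})
      = (n choose l) * card {s \<in> good l (2 * l). set s = {..<l}}"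
    using n_subsets[of "{..<n}" l] by (simp add: \<F>_def)
  finally show ?thesis .
qed

section \<open>Cycles inside a single level\<close>

text \<open>The flip sequence of the walk \<open>{c\<^sub>0}, {c\<^sub>0, c\<^sub>1}, {c\<^sub>1}, {c\<^sub>1, c\<^sub>2}, \<dots>, {c\<^sub>l\<^sub>-\<^sub>1, c\<^sub>0}\<close>,
  where \<open>l\<close> is the length of \<open>c\<close>.\<close>

definition zigzag :: "nat list \<Rightarrow> nat list" where
  "zigzag c = map (\<lambda>i. if even i then c ! (Suc (i div 2) mod length c) else c ! (i div 2))
     [0..<2 * length c]"

text \<open>The vertex at time \<open>i\<close>: a singleton at even times, a pair at odd times. In
  the even case the reduction modulo the length serves the final time \<open>2 * length c\<close>,
  when the walk is back at its start.\<close>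

definition zigzag_set :: "nat list \<Rightarrow> nat \<Rightarrow> nat set" where
  "zigzag_set c i = (if even i then {c ! (i div 2 mod length c)}
     else {c ! (i div 2), c ! (Suc (i div 2) mod length c)})"

lemma par_zigzag:
  assumes c: "distinct c" "length c \<ge> 2" and i: "i \<le> 2 * length c"
  shows "par (take i (zigzag c)) = {c ! 0} \<triangle> zigzag_set c i"
  using i
proof (induction i)
  case 0
  then show ?case by (simp add: zigzag_set_def)
next
  case (Suc i)
  define l where "l = length c"
  have il: "i div 2 < l" using Suc.prems by (simp add: l_def)
  have ne: "c ! (i div 2) \<noteq> c ! (Suc (i div 2) mod l)"
  proof -
    have "Suc (i div 2) mod l < l" using il by (intro mod_less_divisor) linarith
    then show ?thesis
      using c il Suc_mod_neq[of l "i div 2"] by (simp add: l_def nth_eq_iff_index_eq)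
  qed
  have "zigzag c ! i = (if even i then c ! (Suc (i div 2) mod l) else c ! (i div 2))"
    using Suc.prems by (simp add: zigzag_def l_def)
  moreover have "zigzag_set c i = (if even i then {c ! (i div 2)}
      else {c ! (i div 2), c ! (Suc (i div 2) mod l)})"
    using il by (simp add: zigzag_set_def l_def)
  moreover have "zigzag_set c (Suc i) = (if even i then {c ! (i div 2), c ! (Suc (i div 2) mod l)}
      else {c ! (Suc (i div 2) mod l)})"
    by (simp add: zigzag_set_def l_def)
  moreover have "{a} \<triangle> {b} = {a, b}" "{a, b} \<triangle> {a} = {b}" if "a \<noteq> b" for a b :: nat
    using that by auto
  note this[OF ne]
  ultimately have "zigzag_set c i \<triangle> {zigzag c ! i} = zigzag_set c (Suc i)"
    by (cases "even i") simp_all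
  then show ?case
    using Suc by (simp add: par_take_Suc zigzag_def sdiff_assoc)
qed

text \<open>The size of a vertex reveals the parity of its time. A singleton or a pair of cyclically
  consecutive entries then reveals the position, for pairs because \<open>l \<ge> 3\<close>.\<close>

lemma zigzag_good:
  assumes c: "distinct c" "length c = l" "set c \<subseteq> {..<n}" and l: "l \<ge> 3"
  shows "zigzag c \<in> good n (2 * l)"
proof -
  have par: "par (take i (zigzag c)) = {c ! 0} \<triangle> zigzag_set c i" if "i \<le> 2 * l" for i
    using par_zigzag[OF c(1)] c(2) l that by simp
  have nth_eq: "c ! i = c ! j \<longleftrightarrow> i = j" if "i < l" "j < l" for i j
    using c(1,2) that by (simp add: nth_eq_iff_index_eq)
  have "inj_on (\<lambda>j. par (take j (zigzag c))) {..<2 * l}"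
  proof (rule inj_onI)
    fix i j assume ij: "i \<in> {..<2 * l}" "j \<in> {..<2 * l}"
      "par (take i (zigzag c)) = par (take j (zigzag c))"
    then have eq: "zigzag_set c i = zigzag_set c j" using par by simp
    have d: "i div 2 < l" "j div 2 < l" using ij by auto
    have ne: "c ! x \<noteq> c ! (Suc x mod l)" if "x < l" for x
      using Suc_mod_neq[of l x] l that by (simp add: nth_eq)
    have card: "card (zigzag_set c i) = (if even i then 1 else 2)" if "i div 2 < l" for i
      using ne[OF that] c(2) by (simp add: zigzag_set_def)
    have "card (zigzag_set c i) = card (zigzag_set c j)" using eq by (rule arg_cong)
    then have "(if even i then 1 else 2) = (if even j then 1 else (2::nat))"
      unfolding card[OF d(1)] card[OF d(2)] .
    then have parity: "even i \<longleftrightarrow> even j" by (cases "even i"; cases "even j") simp_all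
    have "i div 2 = j div 2"
    proof (cases "even i")
      case True
      then show ?thesis using eq parity d c(2) by (simp add: zigzag_set_def nth_eq)
    next
      case False
      then have "{c ! (i div 2), c ! (Suc (i div 2) mod l)} = {c ! (j div 2), c ! (Suc (j div 2) mod l)}"
        using eq parity c(2) by (simp add: zigzag_set_def)
      then have "i div 2 = j div 2 \<or>
          i div 2 = Suc (j div 2) mod l \<and> j div 2 = Suc (i div 2) mod l"
        using d by (auto simp: doubleton_eq_iff nth_eq)
      \<comment> \<open>Two positions that are cyclic successors of each other would force
        \<open>l \<le> 2\<close>.\<close>
      moreover have False if "x < l" "y < l" "x = Suc y mod l" "y = Suc x mod l" for x y
      proof -
        have "Suc z mod l = 0 \<and> Suc z = l \<or> Suc z mod l = Suc z" if "z < l" for z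
          using that by (cases "Suc z = l") auto
        from this[OF that(2)] this[OF that(1)]
        have "x = 0 \<and> Suc y = l \<or> x = Suc y" "y = 0 \<and> Suc x = l \<or> y = Suc x"
          unfolding that(3)[symmetric] that(4)[symmetric] .
        then show False using l by (elim disjE conjE) linarith+
      qed
      ultimately show ?thesis using d by metis
    qed
    moreover have "i mod 2 = j mod 2" using parity by (simp add: parity mod_2_eq_odd)
    ultimately show "i = j" by (metis mult_div_mod_eq)
  qed
  moreover have len: "length (zigzag c) = 2 * l" using c(2) by (simp add: zigzag_def)
  moreover have "par (zigzag c) = {}"
    using par[of "2 * l"] len c(2) l by (simp add: zigzag_set_def)
  moreover have "set (zigzag c) \<subseteq> set c"
    using c(2) l by (auto simp: zigzag_def intro!: nth_mem mod_less_divisor)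
  ultimately show ?thesis using c(3) by (auto simp: good_def)
qed

text \<open>In the subcube spanned by \<open>set c\<close>, the zigzag runs between relative weights
  1 and 2 if \<open>b\<close> holds, and its complement between \<open>l - 1\<close> and
  \<open>l - 2\<close> otherwise. \<open>R\<close> fixes the position of the subcube.\<close>

definition single_level_walks :: "nat \<Rightarrow> nat \<Rightarrow> (nat set \<times> nat list) set" where
  "single_level_walks n l =
    (\<lambda>(c, R, b). (if b then insert (c ! 0) R else {..<n} - insert (c ! 0) R, zigzag c)) `
      (SIGMA c : {c. length c = l \<and> distinct c \<and> set c \<subseteq> {..<n}}. Pow ({..<n} - set c) \<times> UNIV)"

text \<open>The parametrisation is injective: \<open>c\<close> consists of the odd-indexed entries
  of the flip sequence, \<open>b\<close> tells whether \<open>c ! 0\<close> is in the start vertex,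
  and \<open>R\<close> is what remains.\<close>

lemma card_single_level_walks:
  assumes l: "l \<ge> 1" and n: "n \<ge> l"
  shows "card (single_level_walks n l) = 2 * fact l * (n choose l) * 2 ^ (n - l)"
proof -
  let ?C = "{c. length c = l \<and> distinct c \<and> set c \<subseteq> {..<n}}"
  let ?S = "SIGMA c : ?C. Pow ({..<n} - set c) \<times> (UNIV :: bool set)"
  let ?f = "\<lambda>(c, R, b). (if b then insert (c ! 0) R else {..<n} - insert (c ! 0) R, zigzag c)"
  have finC: "finite ?C"
    by (rule finite_subset[OF _ finite_lists_length_eq[of "{..<n}" l]]) auto
  have "inj_on ?f ?S"
  proof (rule inj_onI)
    fix x y assume x: "x \<in> ?S" and y: "y \<in> ?S" and eq: "?f x = ?f y"
    obtain c R b where x': "x = (c, R, b)" by (cases x)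
    obtain d Q e where y': "y = (d, Q, e)" by (cases y)
    have c: "length c = l" "set c \<subseteq> {..<n}" "R \<subseteq> {..<n} - set c"
      and d: "length d = l" "set d \<subseteq> {..<n}" "Q \<subseteq> {..<n} - set d"
      using x y x' y' by auto
    have "zigzag c = zigzag d" using eq x' y' by simp
    have nthc: "c ! j = zigzag c ! (2 * j + 1)" "d ! j = zigzag d ! (2 * j + 1)" if "j < l" for j
      using that c d by (simp_all add: zigzag_def)
    have "c = d"
      by (rule nth_equalityI) (use c d nthc \<open>zigzag c = zigzag d\<close> in auto)
    have c0: "c ! 0 \<in> set c" using c l by simp
    have X: "(if b then insert (c ! 0) R else {..<n} - insert (c ! 0) R)
        = (if e then insert (c ! 0) Q else {..<n} - insert (c ! 0) Q)"
      using eq unfolding x' y' prod.case \<open>c = d\<close> prod.inject by (rule conjunct1)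
    have "c ! 0 \<in> (if b then insert (c ! 0) R else {..<n} - insert (c ! 0) R) \<longleftrightarrow> b"
      "c ! 0 \<in> (if e then insert (c ! 0) Q else {..<n} - insert (c ! 0) Q) \<longleftrightarrow> e" by auto
    then have "b = e" using X by simp
    have "insert (c ! 0) R \<subseteq> {..<n}" "insert (c ! 0) Q \<subseteq> {..<n}"
      using c d c0 \<open>c = d\<close> by auto
    then have "insert (c ! 0) R = insert (c ! 0) Q"
      using X \<open>b = e\<close> by (cases e) (auto simp: double_diff dest: arg_cong[of _ _ "\<lambda>X. {..<n} - X"])
    moreover have "c ! 0 \<notin> R" "c ! 0 \<notin> Q" using c d c0 \<open>c = d\<close> by auto
    ultimately have "R = Q" by (simp add: insert_ident)
    then show "x = y" using \<open>b = e\<close> \<open>c = d\<close> x' y' by simp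
  qed
  then have "card (single_level_walks n l) = card ?S"
    unfolding single_level_walks_def by (rule card_image)
  also have "\<dots> = (\<Sum>c\<in>?C. card (Pow ({..<n} - set c) \<times> (UNIV :: bool set)))"
    using finC by (intro card_SigmaI) auto
  also have "\<dots> = (\<Sum>c\<in>?C. 2 ^ (n - l) * 2)"
  proof (rule sum.cong[OF refl])
    fix c assume "c \<in> ?C"
    then have "card ({..<n} - set c) = n - l"
      by (auto simp: card_Diff_subset distinct_card)
    then show "card (Pow ({..<n} - set c) \<times> (UNIV :: bool set)) = 2 ^ (n - l) * 2"
      by (simp add: card_cartesian_product card_Pow)
  qed
  also have "\<dots> = card ?C * (2 ^ (n - l) * 2)" by simp
  also have "card ?C = fact l * (n choose l)"
  proof -
    have "card ?C = \<Prod>{n - l + 1..n}"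
      using card_lists_distinct_length_eq[of "{..<n}" l] n by simp
    also have "\<dots> = fact n div fact (n - l)" using fact_div_fact[of "n - l" n] by simp
    also have "fact n = (fact l * (n choose l)) * fact (n - l)"
      using binomial_fact_lemma[OF n] by (simp add: mult_ac)
    finally show ?thesis by simp
  qed
  finally show ?thesis by (simp add: mult_ac)
qed

lemma lev_complement:
  assumes "X \<subseteq> {..<n}" "i < n"
  shows "lev ({..<n} - X) i = n - 1 - lev X i"
proof -
  have "{..<n} - X - {i} = ({..<n} - {i}) - (X - {i})" by auto
  moreover have "card (({..<n} - {i}) - (X - {i})) = card ({..<n} - {i}) - card (X - {i})"
    using assms by (intro card_Diff_subset) (auto intro: finite_subset)
  ultimately show ?thesis using assms(2) by (simp add: lev_def)
qed

lemma single_level_walks: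
  assumes l: "l \<ge> 3" and W: "(X, s) \<in> single_level_walks n l"
  shows "(X, s) \<in> walks n (2 * l)"
    and "card ((\<lambda>j. lev (X \<triangle> par (take j s)) (s ! j)) ` {..<2 * l}) \<le> 1"
proof -
  obtain c R b where c: "length c = l" "distinct c" "set c \<subseteq> {..<n}" and R: "R \<subseteq> {..<n} - set c"
    and X: "X = (if b then insert (c ! 0) R else {..<n} - insert (c ! 0) R)" and s: "s = zigzag c"
    using W by (auto simp: single_level_walks_def)
  define Y where "Y = insert (c ! 0) R"
  have c0: "c ! 0 \<in> set c" using c l by simp
  have Y: "Y \<subseteq> {..<n}" using c0 c(3) R by (auto simp: Y_def)
  have good: "s \<in> good n (2 * l)" unfolding s using c l by (intro zigzag_good)
  then show "(X, s) \<in> walks n (2 * l)" using X Y by (auto simp: walks_def Y_def)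
  have finR: "finite R" using R by (rule finite_subset) simp
  have lev: "lev (Y \<triangle> par (take j s)) (s ! j) = card R + 1" if j: "j < 2 * l" for j
  proof -
    have jl: "j div 2 < l" using j by simp
    have ne: "c ! (j div 2) \<noteq> c ! (Suc (j div 2) mod l)"
      using c jl l Suc_mod_neq[of l "j div 2"] by (simp add: nth_eq_iff_index_eq)
    have inC: "c ! (j div 2) \<in> set c" "c ! (Suc (j div 2) mod l) \<in> set c"
      using c(1) jl by (auto intro!: nth_mem)
    have nR: "c ! (j div 2) \<notin> R" "c ! (Suc (j div 2) mod l) \<notin> R" using inC R by auto
    have Z: "zigzag_set c j \<subseteq> set c" using inC jl c(1) by (auto simp: zigzag_set_def)
    have "Y \<triangle> par (take j s) = R \<triangle> zigzag_set c j"
    proof -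
      have "c ! 0 \<notin> R" using R c0 by auto
      then have "Y = R \<triangle> {c ! 0}" by (simp add: Y_def sdiff_singleton)
      then show ?thesis
        unfolding s using par_zigzag[OF c(2)] c(1) l j by (simp add: sdiff_assoc)
    qed
    also have "\<dots> = R \<union> zigzag_set c j" using Z R by auto
    finally have *: "Y \<triangle> par (take j s) = R \<union> zigzag_set c j" .
    have sj: "s ! j = (if even j then c ! (Suc (j div 2) mod l) else c ! (j div 2))"
      using j c(1) by (simp add: s zigzag_def)
    \<comment> \<open>The element of the zigzag vertex that is not the flip coordinate.\<close>
    define x where "x = (if even j then c ! (j div 2) else c ! (Suc (j div 2) mod l))"
    have "R \<union> zigzag_set c j - {s ! j} = insert x R"
      using ne nR jl c(1) by (auto simp: sj x_def zigzag_set_def)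
    moreover have "x \<notin> R" using nR by (auto simp: x_def)
    ultimately show ?thesis using finR by (simp add: lev_def *)
  qed
  have "(\<lambda>j. lev (X \<triangle> par (take j s)) (s ! j)) ` {..<2 * l}
      \<subseteq> {if b then card R + 1 else n - 1 - (card R + 1)}"
  proof clarify
    fix j assume j: "j < 2 * l"
    show "lev (X \<triangle> par (take j s)) (s ! j) = (if b then card R + 1 else n - 1 - (card R + 1))"
    proof (cases b)
      case True
      then show ?thesis using lev[OF j] X by (simp add: Y_def)
    next
      case False
      have p: "par (take j s) \<subseteq> {..<n}" by (rule goodD(6)[OF good])
      have "X = {..<n} - Y" using False X by (simp add: Y_def)
      then have "X \<triangle> par (take j s) = {..<n} - (Y \<triangle> par (take j s))" using p Y by auto
      then show ?thesis
        using lev[OF j] lev_complement[OF sdiff_subset[OF Y p] goodD(5)[OF good j]] False by simp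
    qed
  qed
  then show "card ((\<lambda>j. lev (X \<triangle> par (take j s)) (s ! j)) ` {..<2 * l}) \<le> 1"
    using card_mono[of "{if b then card R + 1 else n - 1 - (card R + 1)}"] by fastforce
qed

subsection \<open>The bounds\<close>

text \<open>By \<open>walk_levels\<close>, averaging applies to all walks with \<open>b = l\<close>;
  the automorphism factor cancels. For \<open>l > k\<close> the bound is negative.\<close>

lemma copy_density_lower_levels:
  assumes k: "k \<ge> 1" and l: "l \<ge> 2" and n: "n \<ge> l"
  shows "1 - real l / real k \<le> copy_density (hypercube n) (cycle_graph (2 * l)) (hypercube k)"
proof (cases "l \<le> k")
  case False
  then have "1 - real l / real k \<le> 0" using k by (simp add: field_simps)
  then show ?thesis by (simp add: copy_density_def order_trans[of _ 0])
next
  case True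
  have m: "2 * l \<ge> 2" using l by simp
  define A where "A = card (automorphisms (cycle_graph (2 * l)))"
  define N where "N = num_copies (hypercube n) (cycle_graph (2 * l))"
  define E where "E = ex_copies (hypercube n) (cycle_graph (2 * l)) (hypercube k)"
  have A: "A > 0" unfolding A_def by (rule card_automorphisms_pos[OF simple_cycle_graph[OF m]]) simp
  have N: "N > 0" unfolding N_def by (rule num_copies_hypercube_cycle_pos[OF l n])
  have "(k - l) * card (walks n (2 * l)) \<le> k * (A * E)"
    unfolding A_def E_def
    by (rule ex_copies_lower[OF m order_refl]) (use walk_levels[of _ _ n "2 * l"] in auto)
  then have "A * ((k - l) * N) \<le> A * (k * E)"
    unfolding card_walks_num_copies[OF m] A_def[symmetric] N_def[symmetric] by (simp only: mult_ac)
  then have "(k - l) * N \<le> k * E" using A by simp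
  then have "real ((k - l) * N) \<le> real (k * E)" by (rule of_nat_mono)
  then have "(real k - real l) * real N \<le> real k * real E"
    using True by (simp add: of_nat_diff)
  then show ?thesis
    using N k unfolding copy_density_def N_def[symmetric] E_def[symmetric]
    by (simp add: field_simps)
qed

text \<open>Averaging over the single-level walks with \<open>b = 1\<close> bounds the extremal
  number from below, and \<open>card_good_upper\<close> bounds the number of all cycles from above
  by \<open>X * z * (1 + c)\<close>.\<close>

lemma copy_density_lower_single_level:
  assumes k: "k \<ge> 1" and l: "l \<ge> 3" and n: "n \<ge> l"
  shows "(1 - 1 / real k) * (fact (l - 1) / (2 * real (full_cycles l l)))
      * (1 - real (2 ^ l * (l - 1) ^ (2 * l) * l ^ l) / real n)
    \<le> copy_density (hypercube n) (cycle_graph (2 * l)) (hypercube k)"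
proof (cases "full_cycles l l = 0")
  \<comment> \<open>Division by zero yields 0, so the left-hand side vanishes.\<close>
  case True
  then show ?thesis by (simp add: copy_density_def)
next
  case False
  have m: "2 * l \<ge> 2" using l by simp
  define a where "a = card (automorphisms (cycle_graph (2 * l)))"
  define A where "A = real a"
  define N where "N = real (num_copies (hypercube n) (cycle_graph (2 * l)))"
  define e where "e = ex_copies (hypercube n) (cycle_graph (2 * l)) (hypercube k)"
  define E where "E = real e"
  define z where "z = real (full_cycles l l)"
  \<comment> \<open>The number of subcubes of dimension \<open>l\<close>.\<close>
  define X where "X = real (n choose l) * 2 ^ (n - l)"
  define c where "c = real (2 ^ l * (l - 1) ^ (2 * l) * l ^ l) / real n"
  have n0: "real n > 0" using n l by simp
  have z1: "z \<ge> 1" using False by (simp add: z_def)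
  have "a > 0" unfolding a_def by (rule card_automorphisms_pos[OF simple_cycle_graph[OF m]]) simp
  then have A1: "A \<ge> 1" by (simp add: A_def)
  have A2: "A \<le> 4 * real l"
    using card_automorphisms_cycle[of "2 * l"] l by (simp add: A_def a_def)
  have N0: "N > 0" unfolding N_def using num_copies_hypercube_cycle_pos[of l n] l n by simp
  have c0: "c \<ge> 0" by (simp add: c_def)
  have X0: "X > 0" using n by (simp add: X_def)
  have "(k - 1) * card (single_level_walks n l) \<le> k * (a * e)"
    unfolding a_def e_def
    by (rule ex_copies_lower[OF m]) (use single_level_walks[OF l] in auto)
  then have "(k - 1) * (2 * fact l * (n choose l) * 2 ^ (n - l)) \<le> k * (a * e)"
    using l n by (simp add: card_single_level_walks)
  then have "real ((k - 1) * (2 * fact l * (n choose l) * 2 ^ (n - l))) \<le> real (k * (a * e))"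
    by (rule of_nat_mono)
  then have 1: "(real k - 1) * (2 * fact l * X) \<le> real k * (A * E)"
    using k by (simp add: of_nat_diff X_def A_def E_def mult_ac)
  also have "\<dots> \<le> real k * (4 * real l * E)"
    using A2 by (intro mult_left_mono mult_right_mono) (auto simp: E_def)
  finally have "(real k - 1) * (2 * (real l * fact (l - 1)) * X) \<le> real k * (4 * real l * E)"
    using fact_reduce[of l, where ?'a = real] l by simp
  then have "real l * ((real k - 1) * fact (l - 1) * X) \<le> real l * (real k * 2 * E)"
    by (simp add: mult_ac)
  then have "(real k - 1) * fact (l - 1) * X \<le> real k * 2 * E" using l by simp
  then have E: "(1 - 1 / real k) * (fact (l - 1) / 2) * X \<le> E"
    using k by (simp add: field_simps)
  have pow: "(2::real) ^ n = 2 ^ (n - l) * 2 ^ l" using n by (simp flip: power_add)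
  define g where "g = card {s \<in> good l (2 * l). set s = {..<l}}"
  have "a * num_copies (hypercube n) (cycle_graph (2 * l)) = 2 ^ n * card (good n (2 * l))"
    unfolding a_def card_walks_num_copies[OF m, symmetric] by (rule card_walks)
  also have "\<dots> \<le> 2 ^ n * ((n choose l) * g + n ^ (l - 1) * (l - 1) ^ (2 * l))"
    unfolding g_def using card_good_upper[of l n] l by (intro mult_left_mono) auto
  finally have "real (a * num_copies (hypercube n) (cycle_graph (2 * l)))
      \<le> real (2 ^ n * ((n choose l) * g + n ^ (l - 1) * (l - 1) ^ (2 * l)))"
    by (rule of_nat_mono)
  then have "A * N \<le> 2 ^ n * (real (n choose l) * real g) + 2 ^ n * (real n ^ (l - 1) * real (l - 1) ^ (2 * l))"
    by (simp add: A_def N_def distrib_left)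
  also have "2 ^ n * (real (n choose l) * real g) = X * (2 ^ l * real g)"
    by (simp add: X_def pow)
  also have "2 ^ l * real g = A * z"
  proof -
    have "2 ^ l * g = a * full_cycles l l"
      unfolding g_def a_def using card_good_full_cycles[of l] l by simp
    then have "real (2 ^ l * g) = real (a * full_cycles l l)" by (rule arg_cong)
    then show ?thesis by (simp add: A_def z_def)
  qed
  also have "2 ^ n * (real n ^ (l - 1) * real (l - 1) ^ (2 * l)) \<le> X * c"
  proof -
    have "(real n / real l) ^ l \<le> real (n choose l)"
      using binomial_ge_n_over_k_pow_k[OF n] by simp
    then have "real n ^ l \<le> real (n choose l) * real l ^ l"
      using l by (simp add: power_divide field_simps)
    moreover have "real n ^ l = real n * real n ^ (l - 1)"
      using l by (simp add: power_eq_if)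
    ultimately have "real n ^ (l - 1) \<le> real (n choose l) * real l ^ l / real n"
      using n0 by (simp add: field_simps)
    then have "2 ^ n * (real n ^ (l - 1) * real (l - 1) ^ (2 * l))
        \<le> 2 ^ n * ((real (n choose l) * real l ^ l / real n) * real (l - 1) ^ (2 * l))"
      by (intro mult_left_mono mult_right_mono) auto
    also have "\<dots> = X * c" by (simp add: X_def c_def pow mult_ac)
    finally show ?thesis .
  qed
  finally have "A * N \<le> X * (A * z) + X * c" by simp
  also have "X * c \<le> A * z * (X * c)"
  proof -
    have "1 * 1 \<le> A * z" using A1 z1 by (intro mult_mono) auto
    then show ?thesis using X0 c0 mult_right_mono[of 1 "A * z" "X * c"] by simp
  qed
  finally have "A * N \<le> A * (X * z * (1 + c))" by (simp add: algebra_simps)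
  then have N: "N \<le> X * z * (1 + c)" using A1 by simp
  define b where "b = (1 - 1 / real k) * (fact (l - 1) / 2)"
  have b: "b \<ge> 0" using k by (simp add: b_def)
  show ?thesis
  proof (cases "c \<le> 1")
    case True
    \<comment> \<open>The error in the denominator moves to the numerator because
      \<open>(1 - c) * (1 + c) \<le> 1\<close>.\<close>
    have "b / z * (1 - c) * N \<le> b / z * (1 - c) * (X * z * (1 + c))"
      using N b z1 True by (intro mult_left_mono) auto
    also have "\<dots> = b * X * (1 - c\<^sup>2)" using z1 by (simp add: field_simps power2_eq_square)
    also have "\<dots> \<le> b * X * 1" using b X0 by (intro mult_left_mono) auto
    also have "\<dots> \<le> E" using E by (simp add: b_def)
    finally have "b / z * (1 - c) \<le> E / N" using N0 by (simp add: pos_le_divide_eq)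
    then show ?thesis by (simp add: copy_density_def b_def z_def c_def E_def N_def e_def)
  next
    case False
    then have "b / z * (1 - c) \<le> 0" using b z1 by (intro mult_nonneg_nonpos) auto
    also have "0 \<le> E / N" using N0 by (simp add: E_def)
    finally show ?thesis by (simp add: copy_density_def b_def z_def c_def E_def N_def e_def)
  qed
qed

text \<open>The quotient with \<open>full_cycles 2 2\<close> is at most \<open>1 / 2\<close>, also
  when division by zero makes it 0. The remaining inequality is an equality at
  \<open>k = 3\<close>.\<close>

lemma cycle_graph_4_bound:
  assumes "k \<ge> 3"
  shows "(1 - 1 / real k) * (fact (2 - 1) / (2 * real (full_cycles 2 2))) \<le> 1 - 2 / real k"
proof -
  have "(1 - 1 / real k) * (1 / (2 * real (full_cycles 2 2))) \<le> (1 - 1 / real k) * (1 / 2)"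
    using assms by (intro mult_left_mono) (cases "full_cycles 2 2", auto simp: field_simps)
  also have "\<dots> \<le> 1 - 2 / real k" using assms by (simp add: field_simps)
  finally show ?thesis by simp
qed

text \<open>The exception concerns the first lower bound only: for \<open>k = l = 2\<close> the
  density is 0, and so is \<open>1 - l / k\<close>.\<close>

theorem theorem5:
  "\<exists>\<alpha>::real. \<alpha> > 0 \<and>
     (\<forall>k l :: nat. k \<ge> 2 \<longrightarrow> l \<ge> 2 \<longrightarrow>
       (\<exists>\<epsilon> :: nat \<Rightarrow> real. (\<forall>n. \<epsilon> n \<ge> 0) \<and> \<epsilon> \<longlonglongrightarrow> 0 \<and>
         (\<forall>\<^sub>F n in sequentially.
            (\<not> (k = 2 \<and> l = 2) \<longrightarrow>
               max ((1 - 1 / real k) * (fact (l - 1) / (2 * real (full_cycles l l))) * (1 - \<epsilon> n))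
                   (1 - real l / real k)
                 \<le> copy_density (hypercube n) (cycle_graph (2 * l)) (hypercube k)) \<and>
            1 - real l / real k
              \<le> copy_density (hypercube n) (cycle_graph (2 * l)) (hypercube k) \<and>
            copy_density (hypercube n) (cycle_graph (2 * l)) (hypercube k)
              \<le> 1 - \<alpha> * (ln (real k) / (real k * 2 ^ k)))))"
proof (intro exI[of _ "1 / 32 :: real"] conjI allI impI)
  fix k l :: nat assume k: "k \<ge> 2" and l: "l \<ge> 2"
  define \<epsilon> where "\<epsilon> n = real (2 ^ l * (l - 1) ^ (2 * l) * l ^ l) / real n" for n
  let ?d = "\<lambda>n. copy_density (hypercube n) (cycle_graph (2 * l)) (hypercube k)"
  let ?B = "(1 - 1 / real k) * (fact (l - 1) / (2 * real (full_cycles l l)))"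
  have nonneg: "\<epsilon> n \<ge> 0" for n by (simp add: \<epsilon>_def)
  have lim: "\<epsilon> \<longlonglongrightarrow> 0" unfolding \<epsilon>_def by (rule lim_const_over_n)
  have "(\<not> (k = 2 \<and> l = 2) \<longrightarrow> max (?B * (1 - \<epsilon> n)) (1 - real l / real k) \<le> ?d n) \<and>
      1 - real l / real k \<le> ?d n \<and> ?d n \<le> 1 - 1 / 32 * (ln (real k) / (real k * 2 ^ k))"
    if n: "n \<ge> max l (k + 2)" for n
  proof -
    have low: "1 - real l / real k \<le> ?d n"
      using copy_density_lower_levels[of k l n] k l n by simp
    have up: "?d n \<le> 1 - 1 / 32 * (ln (real k) / (real k * 2 ^ k))"
      using num_copies_hypercube_cycle_pos[of l n] k l n by (intro copy_density_upper) auto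
    \<comment> \<open>Zigzags need \<open>l \<ge> 3\<close>. For \<open>l = 2\<close> the assumption
      leaves \<open>k \<ge> 3\<close>, where the bound by levels is the larger one.\<close>
    have "?B * (1 - \<epsilon> n) \<le> ?d n" if "\<not> (k = 2 \<and> l = 2)"
    proof (cases "l = 2")
      case True
      have "?B * (1 - \<epsilon> n) \<le> ?B * 1" using k nonneg by (intro mult_left_mono) auto
      also have "?B * 1 \<le> 1 - real l / real k"
        using cycle_graph_4_bound[of k] that k True by simp
      finally show ?thesis using low by simp
    next
      case False
      then show ?thesis
        unfolding \<epsilon>_def using copy_density_lower_single_level[of k l n] k l n by simp
    qed
    then show ?thesis using low up by simp
  qed
  then have "\<forall>\<^sub>F n in sequentially.
      (\<not> (k = 2 \<and> l = 2) \<longrightarrow> max (?B * (1 - \<epsilon> n)) (1 - real l / real k) \<le> ?d n) \<and>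
      1 - real l / real k \<le> ?d n \<and> ?d n \<le> 1 - 1 / 32 * (ln (real k) / (real k * 2 ^ k))"
    by (rule eventually_sequentiallyI)
  then show "\<exists>\<epsilon> :: nat \<Rightarrow> real. (\<forall>n. \<epsilon> n \<ge> 0) \<and> \<epsilon> \<longlonglongrightarrow> 0 \<and>
      (\<forall>\<^sub>F n in sequentially.
        (\<not> (k = 2 \<and> l = 2) \<longrightarrow> max (?B * (1 - \<epsilon> n)) (1 - real l / real k) \<le> ?d n) \<and>
        1 - real l / real k \<le> ?d n \<and> ?d n \<le> 1 - 1 / 32 * (ln (real k) / (real k * 2 ^ k)))"
    using nonneg lim by blast
qed simp

end
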